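(* Let $p>3$ be a prime and let $x\neq -1/2$ be a $p$-adic integer. Then $$ \sum_{n=0}^{p-1}s_n(x)^2\equiv (-1)^{\langle x\rangle_p}\frac{p+2(x-\langle x\rangle_p)}{2x+1}\pmod{p^3}, $$ where $$ s_n(x)=\sum_{k=0}^n\binom{n}{k}\binom{x}{k}\binom{x+k}{k} $$ and $\langle x\rangle_p$ denotes the least nonnegative residue of $x$ modulo $p$, i.e. the unique integer $m\in\{0,1,\ldots,p-1\}$ with $x\equiv m\pmod p$.
   Context: For a $p$-adic integer $y$ and a nonnegative integer $k$, $\binom{y}{k}=y(y-1)\cdots(y-k+1)/k!$. For $p$-adic numbers $a,b$, $a\equiv b\pmod{p^3}$ means that $(a-b)/p^3$ is a $p$-adic integer. *)

theory Defs
  imports "HOL-Computational_Algebra.Primes"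
begin

text \<open>The ring of p-adic integers, modelled as the inverse limit of the rings
  Z/p^n Z: an element is a coherent sequence of canonical residues
  f n \<in> {0..<p^n} with f n = f (n+1) mod p^n.  Ring operations are computed
  componentwise (reduction mod p^n is a ring homomorphism).\<close>

definition zp :: "nat \<Rightarrow> (nat \<Rightarrow> int) set" where
  "zp p = {f. \<forall>n. 0 \<le> f n \<and> f n < int p ^ n \<and> f n = f (Suc n) mod int p ^ n}"

definition zp_of_int :: "nat \<Rightarrow> int \<Rightarrow> nat \<Rightarrow> int" where
  "zp_of_int p c = (\<lambda>n. c mod int p ^ n)"

definition zp_add :: "nat \<Rightarrow> (nat \<Rightarrow> int) \<Rightarrow> (nat \<Rightarrow> int) \<Rightarrow> nat \<Rightarrow> int" where
  "zp_add p f g = (\<lambda>n. (f n + g n) mod int p ^ n)"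

definition zp_neg :: "nat \<Rightarrow> (nat \<Rightarrow> int) \<Rightarrow> nat \<Rightarrow> int" where
  "zp_neg p f = (\<lambda>n. (- f n) mod int p ^ n)"

definition zp_diff :: "nat \<Rightarrow> (nat \<Rightarrow> int) \<Rightarrow> (nat \<Rightarrow> int) \<Rightarrow> nat \<Rightarrow> int" where
  "zp_diff p f g = zp_add p f (zp_neg p g)"

definition zp_mul :: "nat \<Rightarrow> (nat \<Rightarrow> int) \<Rightarrow> (nat \<Rightarrow> int) \<Rightarrow> nat \<Rightarrow> int" where
  "zp_mul p f g = (\<lambda>n. (f n * g n) mod int p ^ n)"

definition zp_sum :: "nat \<Rightarrow> ('a \<Rightarrow> nat \<Rightarrow> int) \<Rightarrow> 'a set \<Rightarrow> nat \<Rightarrow> int" where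
  "zp_sum p F A = (\<lambda>n. (\<Sum>a\<in>A. F a n) mod int p ^ n)"

definition zp_prod :: "nat \<Rightarrow> ('a \<Rightarrow> nat \<Rightarrow> int) \<Rightarrow> 'a set \<Rightarrow> nat \<Rightarrow> int" where
  "zp_prod p F A = (\<lambda>n. (\<Prod>a\<in>A. F a n) mod int p ^ n)"

definition zp_binom :: "nat \<Rightarrow> (nat \<Rightarrow> int) \<Rightarrow> nat \<Rightarrow> nat \<Rightarrow> int" where
  "zp_binom p y k = (THE z. z \<in> zp p \<and>
     zp_mul p (zp_of_int p (fact k)) z = zp_prod p (\<lambda>i. zp_diff p y (zp_of_int p (int i))) {..<k})"

definition zp_cong :: "nat \<Rightarrow> nat \<Rightarrow> (nat \<Rightarrow> int) \<Rightarrow> (nat \<Rightarrow> int) \<Rightarrow> bool" where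
  "zp_cong p k a b = (\<exists>c\<in>zp p. zp_diff p a b = zp_mul p (zp_of_int p (int p ^ k)) c)"

definition zp_residue :: "nat \<Rightarrow> (nat \<Rightarrow> int) \<Rightarrow> int" where
  "zp_residue p x = (THE m. 0 \<le> m \<and> m < int p \<and> zp_cong p 1 x (zp_of_int p m))"

definition zp_s :: "nat \<Rightarrow> (nat \<Rightarrow> int) \<Rightarrow> nat \<Rightarrow> nat \<Rightarrow> int" where
  "zp_s p x n = zp_sum p (\<lambda>k. zp_mul p (zp_of_int p (int (n choose k)))
      (zp_mul p (zp_binom p x k) (zp_binom p (zp_add p x (zp_of_int p (int k))) k))) {0..n}"

end

theory Submission
  imports Complex_Main Defs
begin

text \<open>
  In the variable \<open>\<lambda> = x(x+1)\<close> the polynomials \<open>s\<^sub>n\<close> are continuous dual Hahn polynomials whose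
  norms are all equal, so the Christoffel--Darboux formula evaluates
  \<open>G(x,y) = \<Sum>\<^sub>n\<^sub><\<^sub>p s\<^sub>n(x) s\<^sub>n(y)\<close> for \<open>x \<noteq> y\<close> through \<open>p\<^sup>2\<close> times a determinant in
  \<open>s\<^sub>p\<close> and \<open>s\<^sub>p\<^sub>-\<^sub>1\<close>, and these two are known modulo \<open>p\<^sup>2\<close> from a second
  recurrence, in \<open>x\<close>. Write \<open>x = a + pt\<close> with \<open>0 \<le> a < p\<close>. Modulo \<open>p\<^sup>3\<close> the function
  \<open>G(a + pt, a + pu)\<close> is a polynomial of total degree two, so its diagonal is interpolated
  from off-diagonal values, without derivatives:
  \<open>3 G(x,x) \<equiv> 4 G(x+p,x-p) - G(x+2p,x-2p)\<close>. This gives \<open>(2x+1) G(x,x)\<close> modulo \<open>p\<^sup>3\<close>.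

  If \<open>p\<close> divides \<open>2x+1\<close>, then \<open>a = (p-1)/2\<close>, and one more power of \<open>p\<close> is needed. There
  \<open>\<lambda>\<close> varies only by multiples of \<open>p\<^sup>2\<close>, which makes \<open>G(x,x)\<close> constant modulo \<open>p\<^sup>3\<close>,
  and \<open>G(a,a)\<close> is computed for \<open>a = 0, 1, 2, \<dots>\<close> modulo \<open>p\<^sup>4\<close> from the recurrence in \<open>x\<close>.
\<close>

section \<open>Christoffel--Darboux formula and dual recurrence\<close>

text \<open>At \<open>l = x * (x + 1)\<close> the factor \<open>l - i * (i + 1)\<close> is
  \<open>(x - i) * (x + i + 1)\<close>, so this is the product of the binomials of \<open>x\<close>
  over \<open>k\<close> and of \<open>x + k\<close> over \<open>k\<close>. With \<open>l\<close> as
  the variable, multiplication by \<open>l\<close> becomes a shift in \<open>k\<close>.\<close>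

definition central_term :: "nat \<Rightarrow> rat \<Rightarrow> rat" where
  "central_term k l = (\<Prod>i<k. l - of_nat i * (of_nat i + 1)) / (fact k)\<^sup>2"

definition s_lambda :: "nat \<Rightarrow> rat \<Rightarrow> rat" where
  "s_lambda n l = (\<Sum>k\<le>n. of_nat (n choose k) * central_term k l)"

definition s_at :: "nat \<Rightarrow> rat \<Rightarrow> rat" where
  "s_at n x = s_lambda n (x * (x + 1))"

lemma central_term_0 [simp]: "central_term 0 l = 1"
  by (simp add: central_term_def)

lemma central_term_Suc:
  "(of_nat k + 1)\<^sup>2 * central_term (Suc k) l = (l - of_nat k * (of_nat k + 1)) * central_term k l"
proof -
  have "(1 + of_nat k :: rat) \<noteq> 0"
    by (metis of_nat_Suc of_nat_eq_0_iff nat.distinct(2))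
  then show ?thesis
    by (simp add: central_term_def power_mult_distrib add.commute mult.commute)
qed

lemma s_lambda_upto:
  assumes "n \<le> m"
  shows "s_lambda n l = (\<Sum>k\<le>m. of_nat (n choose k) * central_term k l)"
  unfolding s_lambda_def
  by (rule sum.mono_neutral_left) (use assms in auto)

lemma s_lambda_0 [simp]: "s_lambda 0 l = 1"
  by (simp add: s_lambda_def)

lemma s_lambda_difference:
  "s_lambda (Suc n) l - s_lambda n l = (\<Sum>k\<le>n. of_nat (n choose k) * central_term (Suc k) l)"
proof -
  have "s_lambda (Suc n) l - s_lambda n l
      = (\<Sum>k\<le>Suc n. (of_nat (Suc n choose k) - of_nat (n choose k)) * central_term k l)"
    unfolding s_lambda_upto [OF order.refl, of "Suc n"] s_lambda_upto [of n "Suc n", OF le_SucI [OF order.refl]]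
    by (simp add: sum_subtractf left_diff_distrib del: sum.atMost_Suc)
  also have "\<dots> = (\<Sum>k\<le>n. of_nat (n choose k) * central_term (Suc k) l)"
    by (subst sum.atMost_Suc_shift) simp
  finally show ?thesis .
qed

lemma of_nat_Suc_choose_Suc:
  "(of_nat k + 1) * (of_nat (Suc n choose Suc k) :: rat) = (of_nat n + 1) * of_nat (n choose k)"
  using arg_cong [OF Suc_times_binomial_eq [of n k], of "of_nat :: nat \<Rightarrow> rat"]
  by (simp add: algebra_simps)

lemma of_nat_choose_absorb:
  "(of_nat k + 1) * (of_nat (n choose Suc k) :: rat) = (of_nat n - of_nat k) * of_nat (n choose k)"
  using of_nat_Suc_choose_Suc [of k n] by (simp add: algebra_simps)

text \<open>Absorption trades the factor \<open>n + 1\<close> for the weight \<open>k\<close>; the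
  added term \<open>k = 0\<close> vanishes.\<close>

lemma s_lambda_weighted_difference:
  "(of_nat n + 1) * (s_lambda (Suc n) l - s_lambda n l)
     = (\<Sum>k\<le>Suc n. of_nat k * of_nat (Suc n choose k) * central_term k l)"
  unfolding s_lambda_difference
  by (subst sum.atMost_Suc_shift) (simp add: sum_distrib_left of_nat_Suc_choose_Suc
      del: binomial_Suc_Suc flip: mult.assoc add.commute [of _ 1])

text \<open>By \<open>central_term_Suc\<close>, multiplying by \<open>l\<close> produces
  \<open>central_term (Suc k)\<close> and \<open>central_term k\<close>; after an index shift only
  an identity of binomial coefficients remains. The two squares are one sequence at consecutive
  indices, which is what makes the Christoffel--Darboux sum telescope.\<close>

lemma s_lambda_recurrence:
  "l * s_lambda (Suc n) l
     = (of_nat n + 2)\<^sup>2 * (s_lambda (Suc (Suc n)) l - s_lambda (Suc n) l)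
       - (of_nat n + 1)\<^sup>2 * (s_lambda (Suc n) l - s_lambda n l)"
proof -
  let ?m = "Suc n"
  have A: "l * s_lambda ?m l = (\<Sum>k\<le>?m. of_nat (?m choose k) *
       ((of_nat k + 1)\<^sup>2 * central_term (Suc k) l + of_nat k * (of_nat k + 1) * central_term k l))"
    unfolding s_lambda_def sum_distrib_left
    unfolding central_term_Suc by (rule sum.cong) (auto simp: algebra_simps simp del: binomial_Suc_Suc)
  have B: "(of_nat n + 2) * (s_lambda (Suc ?m) l - s_lambda ?m l)
      = (\<Sum>k\<le>Suc ?m. of_nat k * of_nat (Suc ?m choose k) * central_term k l)"
    using s_lambda_weighted_difference [of ?m l] by (simp add: algebra_simps del: sum.atMost_Suc)
  have C: "(of_nat n + 1) * (s_lambda ?m l - s_lambda n l)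
      = (\<Sum>k\<le>?m. of_nat k * of_nat (?m choose k) * central_term k l)"
    by (rule s_lambda_weighted_difference)
  have B2: "(of_nat n + 2)\<^sup>2 * (s_lambda (Suc ?m) l - s_lambda ?m l)
      = (\<Sum>k\<le>?m. (of_nat n + 2) * ((of_nat k + 1) * of_nat (Suc ?m choose Suc k)) * central_term (Suc k) l)"
    unfolding power2_eq_square mult.assoc B
    by (subst sum.atMost_Suc_shift) (simp add: sum_distrib_left algebra_simps del: binomial_Suc_Suc sum.atMost_Suc)
  have C2: "(of_nat n + 1)\<^sup>2 * (s_lambda ?m l - s_lambda n l)
      = (\<Sum>k\<le>?m. (of_nat n + 1) * of_nat k * of_nat (?m choose k) * central_term k l)"
    unfolding power2_eq_square mult.assoc C
    by (simp add: sum_distrib_left algebra_simps del: sum.atMost_Suc)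
  have shift: "(\<Sum>k\<le>?m. g k) = (\<Sum>k\<le>?m. g (Suc k))" if "g 0 = 0" "g (Suc ?m) = 0" for g :: "nat \<Rightarrow> rat"
  proof -
    have "(\<Sum>k\<le>Suc ?m. g k) = g 0 + (\<Sum>k\<le>?m. g (Suc k))" by (rule sum.atMost_Suc_shift)
    moreover have "(\<Sum>k\<le>Suc ?m. g k) = (\<Sum>k\<le>?m. g k)" using that by simp
    ultimately show ?thesis using that by simp
  qed
  \<comment> \<open>The shift is free: the term \<open>k = 0\<close> carries the factor
    \<open>k\<close>, and the binomial coefficient vanishes at \<open>k = Suc ?m\<close>.\<close>
  have D: "(\<Sum>k\<le>?m. of_nat k * (of_nat n + 2 + of_nat k) * of_nat (?m choose k) * central_term k l)
     = (\<Sum>k\<le>?m. (of_nat k + 1) * (of_nat n + 3 + of_nat k) * of_nat (?m choose Suc k) * central_term (Suc k) l)"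
    by (subst shift) (auto simp: algebra_simps binomial_eq_0 simp del: binomial_Suc_Suc sum.atMost_Suc)
  \<comment> \<open>Comparison of the coefficients of \<open>central_term (Suc k) l\<close>.\<close>
  have E: "(of_nat k + 1)\<^sup>2 * of_nat (?m choose k) + (of_nat k + 1) * (of_nat n + 3 + of_nat k) * of_nat (?m choose Suc k)
     = (of_nat n + 2) * ((of_nat k + 1) * of_nat (Suc ?m choose Suc k) :: rat)" for k
  proof -
    have 1: "(of_nat k + 1) * (of_nat (Suc ?m choose Suc k) :: rat) = (of_nat n + 2) * of_nat (?m choose k)"
      using of_nat_Suc_choose_Suc [of k ?m] by (simp add: algebra_simps)
    have 2: "(of_nat k + 1) * (of_nat (?m choose Suc k) :: rat) = (of_nat n + 1 - of_nat k) * of_nat (?m choose k)"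
      using of_nat_choose_absorb [of k ?m] by (simp add: algebra_simps)
    have "(of_nat k + 1) * (of_nat n + 3 + of_nat k) * (of_nat (?m choose Suc k)::rat)
       = (of_nat n + 3 + of_nat k) * ((of_nat n + 1 - of_nat k) * of_nat (?m choose k))"
      unfolding 2 [symmetric] by (simp add: mult_ac)
    then show ?thesis unfolding 1 by (simp add: power2_eq_square algebra_simps)
  qed
  have "l * s_lambda ?m l + (of_nat n + 1)\<^sup>2 * (s_lambda ?m l - s_lambda n l)
     = (\<Sum>k\<le>?m. (of_nat k + 1)\<^sup>2 * of_nat (?m choose k) * central_term (Suc k) l)
      + (\<Sum>k\<le>?m. of_nat k * (of_nat n + 2 + of_nat k) * of_nat (?m choose k) * central_term k l)"
    unfolding A C2 sum.distrib [symmetric] by (rule sum.cong) (auto simp: algebra_simps)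
  also have "\<dots> = (\<Sum>k\<le>?m. (of_nat n + 2) * ((of_nat k + 1) * of_nat (Suc ?m choose Suc k)) * central_term (Suc k) l)"
    unfolding D sum.distrib [symmetric] E [symmetric] by (rule sum.cong) (auto simp: algebra_simps)
  finally show ?thesis unfolding B2 by simp
qed

text \<open>Rewriting \<open>l * s\<close> and \<open>m * s\<close> in the new summand by the
  recurrence leaves exactly the difference of two consecutive boundary terms.\<close>

lemma christoffel_darboux:
  "(l - m) * (\<Sum>n<Suc N. s_lambda n l * s_lambda n m)
     = (of_nat N + 1)\<^sup>2 * (s_lambda (Suc N) l * s_lambda N m - s_lambda N l * s_lambda (Suc N) m)"
proof (induction N)
  case 0
  show ?case by (simp add: s_lambda_def central_term_def)
next
  case (Suc N)
  have "(l - m) * (\<Sum>n<Suc (Suc N). s_lambda n l * s_lambda n m)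
     = (l - m) * (\<Sum>n<Suc N. s_lambda n l * s_lambda n m)
       + (l * s_lambda (Suc N) l) * s_lambda (Suc N) m - s_lambda (Suc N) l * (m * s_lambda (Suc N) m)"
    by (simp add: algebra_simps)
  then show ?case
    unfolding Suc.IH s_lambda_recurrence by (simp add: algebra_simps)
qed

section \<open>The recurrence in \<open>x\<close>\<close>

lemma s_at_0: "s_at n 0 = 1"
  unfolding s_at_def s_lambda_def
  by (subst sum.remove [of _ 0]) (auto simp: central_term_def intro!: sum.neutral)

lemma s_at_reflect: "s_at n (- 1 - x) = s_at n x"
  by (simp add: s_at_def algebra_simps)

text \<open>Factoring \<open>(x + 1) * (x + 2) - i * (i + 1)\<close> as
  \<open>(x + 1 - i) * (x + 2 + i)\<close> shows the same linear factors on both sides.\<close>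

lemma numerator_shift:
  fixes x :: rat
  shows "(\<Prod>i<Suc k. (x + 1) * (x + 2) - of_nat i * (of_nat i + 1))
    = (x + of_nat k + 1) * (x + of_nat k + 2) * (\<Prod>i<k. x * (x + 1) - of_nat i * (of_nat i + 1))"
proof (induction k)
  case (Suc k)
  show ?case
    by (subst prod.lessThan_Suc, subst Suc.IH) (simp add: algebra_simps)
qed (simp add: algebra_simps)

text \<open>The index \<open>n\<close> enters only through \<open>2 * n + 1\<close>. The proof goes
  term by term in \<open>k\<close>: all central terms involved are multiples of one common
  \<open>g\<close>.\<close>

lemma s_at_dual_recurrence:
  "(x + 1)\<^sup>2 * s_at n (x + 1) = (2 * x + 1) * (2 * of_nat n + 1) * s_at n x + x\<^sup>2 * s_at n (x - 1)"
proof -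
  let ?e = "\<lambda>k (x::rat). central_term k (x * (x + 1))"
  have step: "(x + 1)\<^sup>2 * ?e (Suc k) (x + 1) - x\<^sup>2 * ?e (Suc k) (x - 1) - (2 * x + 1) * ?e (Suc k) x
     = 2 * (2 * x + 1) * (of_nat k + 1) * (?e (Suc k) x + ?e k x)" for k
  proof -
    define g where "g = (\<Prod>i<k. x * (x + 1) - of_nat i * (of_nat i + 1)) / (fact (Suc k))\<^sup>2"
    have a: "?e (Suc k) (x + 1) = (x + of_nat k + 1) * (x + of_nat k + 2) * g"
    proof -
      have "(x + 1) * (x + 1 + 1) = (x + 1) * (x + 2)" by simp
      then show ?thesis
        unfolding central_term_def g_def by (simp only: numerator_shift times_divide_eq_right)
    qed
    have b: "?e (Suc k) x = (x - of_nat k) * (x + of_nat k + 1) * g"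
    proof -
      have "x * (x + 1) - of_nat k * (of_nat k + 1) = (x - of_nat k) * (x + of_nat k + 1)"
        by (simp add: algebra_simps)
      then show ?thesis
        unfolding central_term_def g_def prod.lessThan_Suc
        by (simp only: times_divide_eq_right mult.commute mult.assoc)
    qed
    \<comment> \<open>The point \<open>x - 1\<close> is reached by \<open>numerator_shift\<close> at
      the reflected point \<open>- 1 - x\<close>.\<close>
    have c: "?e (Suc k) (x - 1) = (x - of_nat k) * (x - of_nat k - 1) * g"
    proof -
      have 1: "(x - 1) * (x - 1 + 1) = (- 1 - x + 1) * (- 1 - x + 2)"
        and 2: "x * (x + 1) = (- 1 - x) * (- 1 - x + 1)"
        and 3: "(- 1 - x + of_nat k + 1) * (- 1 - x + of_nat k + 2) = (x - of_nat k) * (x - of_nat k - 1)"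
        by (simp_all add: algebra_simps)
      show ?thesis
        unfolding central_term_def g_def 1 2 by (simp only: numerator_shift times_divide_eq_right 3)
    qed
    have d: "?e k x = (of_nat k + 1)\<^sup>2 * g"
    proof -
      have "(1 + of_nat k :: rat) \<noteq> 0"
        by (metis of_nat_Suc of_nat_eq_0_iff nat.distinct(2))
      then show ?thesis
        by (simp add: central_term_def g_def power_mult_distrib add.commute mult.commute)
    qed
    show ?thesis unfolding a b c d by (simp add: power2_eq_square algebra_simps)
  qed
  show ?thesis
  proof (cases n)
    case 0
    then show ?thesis by (simp add: s_at_def power2_eq_square algebra_simps)
  next
    case (Suc m)
    have expand: "s_at n y = 1 + (\<Sum>k\<le>m. of_nat (n choose Suc k) * ?e (Suc k) y)" for y
      unfolding s_at_def s_lambda_def Suc by (subst sum.atMost_Suc_shift) simp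
    \<comment> \<open>Here \<open>n\<close> is split as \<open>k + (n - k)\<close> in front of
      \<open>n choose k\<close>, and \<open>n - k\<close> is absorbed into
      \<open>n choose Suc k\<close>.\<close>
    have nx: "of_nat n * s_at n x = (\<Sum>k\<le>m. of_nat (n choose Suc k) * ((of_nat k + 1) * (?e (Suc k) x + ?e k x)))"
    proof -
      have "of_nat n * s_at n x = (\<Sum>k\<le>n. of_nat k * of_nat (n choose k) * ?e k x)
          + (\<Sum>k\<le>n. (of_nat k + 1) * of_nat (n choose Suc k) * ?e k x)"
        unfolding of_nat_choose_absorb s_at_def s_lambda_def sum_distrib_left sum.distrib [symmetric]
        by (rule sum.cong) (auto simp: algebra_simps)
      also have "(\<Sum>k\<le>n. of_nat k * of_nat (n choose k) * ?e k x)
          = (\<Sum>k\<le>m. (of_nat k + 1) * of_nat (n choose Suc k) * ?e (Suc k) x)"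
        unfolding Suc by (subst sum.atMost_Suc_shift) (simp add: algebra_simps del: binomial_Suc_Suc)
      also have "(\<Sum>k\<le>n. (of_nat k + 1) * of_nat (n choose Suc k) * ?e k x)
          = (\<Sum>k\<le>m. (of_nat k + 1) * of_nat (n choose Suc k) * ?e k x)"
        unfolding Suc by (simp del: binomial_Suc_Suc)
      finally show ?thesis
        unfolding sum.distrib [symmetric] by (simp add: algebra_simps del: binomial_Suc_Suc)
    qed
    have "(x + 1)\<^sup>2 * s_at n (x + 1) - x\<^sup>2 * s_at n (x - 1) - (2 * x + 1) * s_at n x
      = (\<Sum>k\<le>m. of_nat (n choose Suc k) * ((x + 1)\<^sup>2 * ?e (Suc k) (x + 1) - x\<^sup>2 * ?e (Suc k) (x - 1) - (2 * x + 1) * ?e (Suc k) x))"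
      unfolding expand
      by (simp add: right_diff_distrib distrib_left sum_subtractf sum_distrib_left mult_ac)
         (simp add: power2_eq_square algebra_simps)
    also have "\<dots> = 2 * (2 * x + 1) * (of_nat n * s_at n x)"
      unfolding step nx sum_distrib_left by (rule sum.cong) (auto simp: algebra_simps)
    finally show ?thesis by (simp add: algebra_simps)
  qed
qed

section \<open>Harmonic sums and generalized binomial coefficients\<close>

definition harmonic :: "nat \<Rightarrow> rat" where
  "harmonic a = (\<Sum>j<a. 1 / of_nat (Suc j))"

lemma harmonic_0 [simp]: "harmonic 0 = 0"
  by (simp add: harmonic_def)

lemma harmonic_Suc: "harmonic (Suc a) = harmonic a + 1 / (of_nat a + 1)"
  by (simp add: harmonic_def add.commute)

lemma of_nat_plus_1_nonzero [simp]: "(of_nat k + 1 :: rat) \<noteq> 0"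
  by (metis of_nat_Suc of_nat_eq_0_iff nat.distinct(2) add.commute)

lemma gbinomial_lessThan: "(x :: rat) gchoose k = (\<Prod>i<k. x - of_nat i) / fact k"
  by (simp add: gbinomial_prod_rev atLeast0LessThan)

text \<open>Reversing the factors of the second binomial pairs \<open>x - i\<close> with
  \<open>x + i + 1\<close>.\<close>

lemma central_term_gbinomial:
  "central_term k (x * (x + 1)) = (x gchoose k) * ((x + of_nat k) gchoose k)"
proof -
  have "(\<Prod>i<k. x + of_nat k - of_nat i) = (\<Prod>i<k. x + of_nat i + 1)"
    by (rule prod.reindex_bij_witness [of _ "\<lambda>i. k - 1 - i" "\<lambda>i. k - 1 - i"]) (auto simp: of_nat_diff)
  moreover have "x * (x + 1) - of_nat i * (of_nat i + 1) = (x - of_nat i) * (x + of_nat i + 1)" for i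
    by (simp add: algebra_simps)
  ultimately show ?thesis
    by (simp add: central_term_def gbinomial_lessThan prod.distrib power2_eq_square)
qed

lemma gbinomial_upper_shift:
  "(x + 1 - of_nat k) * ((x + 1) gchoose k) = (x + 1) * ((x :: rat) gchoose k)"
proof -
  have "(\<Prod>i<k. x + 1 - of_nat i) * (x + 1 - of_nat k) = (\<Prod>i<Suc k. x + 1 - of_nat i)" by simp
  also have "\<dots> = (x + 1) * (\<Prod>i<k. x - of_nat i)"
    by (subst prod.lessThan_Suc_shift) simp
  finally show ?thesis by (simp add: gbinomial_lessThan mult.commute)
qed

definition harmonic2 :: "nat \<Rightarrow> rat" where
  "harmonic2 a = (\<Sum>j<a. (1 / of_nat (Suc j))\<^sup>2)"

lemma harmonic2_Suc: "harmonic2 (Suc a) = harmonic2 a + (1 / (of_nat a + 1))\<^sup>2"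
  by (simp add: harmonic2_def add.commute)

lemma sum_split_parity: "(\<Sum>j<2 * b. g j) = (\<Sum>j<b. g (2 * j) + g (Suc (2 * j)))"
  for g :: "nat \<Rightarrow> rat"
  by (induction b) (simp_all add: add.assoc)

section \<open>Rational numbers integral at \<open>p\<close>\<close>

locale prime_gt_3 =
  fixes p :: nat
  assumes prime_p: "prime p" and p_gt_3: "p > 3"
begin

text \<open>The localization of the integers at \<open>p\<close>. It stands in for the
  \<open>p\<close>-adic integers: a congruence sees only finitely many digits, and inside the
  rationals division is available.\<close>

definition Zp :: "rat set" where
  "Zp = {r. \<exists>a b :: int. \<not> int p dvd b \<and> r = of_int a / of_int b}"

text \<open>Only the difference of the arguments is constrained, not their integrality; hence the
  membership premises in rules such as \<open>pcong_mult\<close>.\<close>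

definition pcong :: "nat \<Rightarrow> rat \<Rightarrow> rat \<Rightarrow> bool" where
  "pcong m r s \<longleftrightarrow> (\<exists>c\<in>Zp. r = s + of_nat p ^ m * c)"

abbreviation P :: rat where "P \<equiv> of_nat p"

lemma p_nonzero [simp]: "p \<noteq> 0"
  using p_gt_3 by simp

lemma P_nonzero: "P \<noteq> 0"
  by simp

lemma prime_int_p: "prime (int p)"
  using prime_p by simp

lemma Zp_divide_of_int:
  assumes "\<not> int p dvd b"
  shows "of_int a / of_int b \<in> Zp"
  using assms unfolding Zp_def by blast

lemma Zp_of_int: "of_int a \<in> Zp"
proof -
  have "\<not> int p dvd 1"
    using prime_int_p not_prime_unit by blast
  from Zp_divide_of_int [OF this, of a] show ?thesis by simp
qed

lemma Zp_of_nat: "of_nat n \<in> Zp"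
  using Zp_of_int [of "int n"] by simp

lemma Zp_numeral: "numeral n \<in> Zp"
  using Zp_of_int [of "numeral n"] by simp

lemma Zp_0: "0 \<in> Zp" and Zp_1: "1 \<in> Zp"
  using Zp_of_int [of 0] Zp_of_int [of 1] by simp_all

lemma Zp_add:
  assumes "r \<in> Zp" "s \<in> Zp"
  shows "r + s \<in> Zp"
proof -
  obtain a b c d where *: "\<not> int p dvd b" "r = of_int a / of_int b"
    "\<not> int p dvd d" "s = of_int c / of_int d"
    using assms unfolding Zp_def by blast
  then have "b \<noteq> 0" "d \<noteq> 0" by auto
  then have "r + s = of_int (a * d + c * b) / of_int (b * d)"
    using * by (simp add: field_simps)
  moreover have "\<not> int p dvd b * d"
    using * prime_int_p prime_dvd_mult_iff by blast
  ultimately show ?thesis using Zp_divide_of_int by metis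
qed

lemma Zp_mult:
  assumes "r \<in> Zp" "s \<in> Zp"
  shows "r * s \<in> Zp"
proof -
  obtain a b c d where *: "\<not> int p dvd b" "r = of_int a / of_int b"
    "\<not> int p dvd d" "s = of_int c / of_int d"
    using assms unfolding Zp_def by blast
  then have "r * s = of_int (a * c) / of_int (b * d)"
    by simp
  moreover have "\<not> int p dvd b * d"
    using * prime_int_p prime_dvd_mult_iff by blast
  ultimately show ?thesis using Zp_divide_of_int by metis
qed

lemma Zp_minus: "r \<in> Zp \<Longrightarrow> - r \<in> Zp"
  using Zp_mult [OF Zp_of_int [of "-1"], of r] by simp

lemma Zp_diff: "r \<in> Zp \<Longrightarrow> s \<in> Zp \<Longrightarrow> r - s \<in> Zp"
  using Zp_add [OF _ Zp_minus, of r s] by simp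

lemma Zp_power: "r \<in> Zp \<Longrightarrow> r ^ n \<in> Zp"
  by (induction n) (auto intro: Zp_1 Zp_mult)

lemma Zp_sum: "(\<And>i. i \<in> I \<Longrightarrow> f i \<in> Zp) \<Longrightarrow> sum f I \<in> Zp"
  by (induction I rule: infinite_finite_induct) (auto intro: Zp_0 Zp_add)

lemma Zp_prod: "(\<And>i. i \<in> I \<Longrightarrow> f i \<in> Zp) \<Longrightarrow> prod f I \<in> Zp"
  by (induction I rule: infinite_finite_induct) (auto intro: Zp_1 Zp_mult)

lemmas Zp_closed = Zp_of_int Zp_of_nat Zp_numeral Zp_0 Zp_1 Zp_add Zp_mult Zp_minus Zp_diff Zp_power
  Zp_sum Zp_prod

lemma Zp_inverse_of_int: "\<not> int p dvd b \<Longrightarrow> inverse (of_int b) \<in> Zp"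
  using Zp_divide_of_int [of b 1] by (simp add: inverse_eq_divide)

lemma Zp_inverse_of_nat:
  assumes "0 < j" "j < p"
  shows "inverse (of_nat j) \<in> Zp"
proof -
  have "\<not> int p dvd int j" using assms nat_dvd_not_less int_dvd_int_iff by blast
  from Zp_inverse_of_int [OF this] show ?thesis by simp
qed

lemma Zp_divide_of_nat: "0 < j \<Longrightarrow> j < p \<Longrightarrow> r \<in> Zp \<Longrightarrow> r / of_nat j \<in> Zp"
  using Zp_mult [OF _ Zp_inverse_of_nat] by (simp add: divide_inverse)

lemma Zp_inverse_fact:
  assumes "k < p"
  shows "inverse (fact k) \<in> Zp"
proof -
  have "\<not> p dvd fact k" using assms prime_p by (simp add: prime_dvd_fact_iff)
  then have "\<not> int p dvd fact k" by (metis int_dvd_int_iff of_nat_fact)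
  from Zp_inverse_of_int [OF this] show ?thesis by simp
qed

section \<open>Calculus of congruences between rational numbers\<close>

lemma pcongI: "r - s = P ^ m * c \<Longrightarrow> c \<in> Zp \<Longrightarrow> pcong m r s"
  unfolding pcong_def by (metis add.commute diff_add_cancel)

lemma pcong_refl: "pcong m r r"
  by (rule pcongI [of _ _ _ 0]) (auto intro: Zp_0)

lemma pcong_sym: "pcong m r s \<Longrightarrow> pcong m s r"
  unfolding pcong_def by (elim bexE, rule_tac x = "- c" in bexI) (auto intro: Zp_minus)

lemma pcong_trans [trans]: "pcong m r s \<Longrightarrow> pcong m s t \<Longrightarrow> pcong m r t"
  unfolding pcong_def by (elim bexE, rule_tac x = "c + ca" in bexI) (auto simp: algebra_simps intro: Zp_add)

lemma pcong_add: "pcong m r r' \<Longrightarrow> pcong m s s' \<Longrightarrow> pcong m (r + s) (r' + s')"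
  unfolding pcong_def by (elim bexE, rule_tac x = "c + ca" in bexI) (auto simp: algebra_simps intro: Zp_add)

lemma pcong_mult_left: "c \<in> Zp \<Longrightarrow> pcong m r s \<Longrightarrow> pcong m (c * r) (c * s)"
  unfolding pcong_def by (elim bexE, rule_tac x = "c * ca" in bexI) (auto simp: algebra_simps intro: Zp_mult)

lemma pcong_minus: "pcong m r s \<Longrightarrow> pcong m (- r) (- s)"
  using pcong_mult_left [OF Zp_minus [OF Zp_1]] by simp

lemma pcong_diff: "pcong m r r' \<Longrightarrow> pcong m s s' \<Longrightarrow> pcong m (r - s) (r' - s')"
  using pcong_add [OF _ pcong_minus] by force

lemma pcong_in_Zp: "pcong m r s \<Longrightarrow> s \<in> Zp \<Longrightarrow> r \<in> Zp"
  unfolding pcong_def by (auto intro!: Zp_closed)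

lemma pcong_mult:
  assumes "pcong m r r'" "pcong m s s'" "r' \<in> Zp" "s' \<in> Zp"
  shows "pcong m (r * s) (r' * s')"
proof -
  have "s \<in> Zp" using assms pcong_in_Zp by blast
  then have "pcong m (s * r) (s * r')" using assms pcong_mult_left by blast
  moreover have "pcong m (r' * s) (r' * s')" using assms pcong_mult_left by blast
  ultimately show ?thesis using pcong_trans by (simp add: mult.commute)
qed

lemma pcong_sum: "(\<And>i. i \<in> I \<Longrightarrow> pcong m (f i) (g i)) \<Longrightarrow> pcong m (sum f I) (sum g I)"
  by (induction I rule: infinite_finite_induct) (auto intro: pcong_refl pcong_add)

lemma pcong_prod:
  "(\<And>i. i \<in> I \<Longrightarrow> pcong m (f i) (g i)) \<Longrightarrow> (\<And>i. i \<in> I \<Longrightarrow> g i \<in> Zp) \<Longrightarrow> pcong m (prod f I) (prod g I)"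
  by (induction I rule: infinite_finite_induct) (auto intro!: pcong_refl pcong_mult Zp_prod)

lemma pcong_weaken:
  assumes "pcong m r s" "k \<le> m"
  shows "pcong k r s"
proof -
  obtain c where "c \<in> Zp" "r = s + P ^ m * c" using assms(1) unfolding pcong_def by blast
  moreover have "P ^ m = P ^ k * P ^ (m - k)" using assms(2) by (simp flip: power_add)
  ultimately show ?thesis
    by (intro pcongI [of _ _ _ "P ^ (m - k) * c"]) (auto intro!: Zp_closed)
qed

lemma pcong_scale: "pcong m r s \<Longrightarrow> pcong (k + m) (P ^ k * r) (P ^ k * s)"
  unfolding pcong_def by (auto simp: power_add algebra_simps)

lemma pcong_descale: "pcong (k + m) (P ^ k * r) (P ^ k * s) \<Longrightarrow> pcong m r s"
  unfolding pcong_def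
proof (elim bexE, rule_tac x = c in bexI)
  fix c assume "P ^ k * r = P ^ k * s + P ^ (k + m) * c"
  then have "P ^ k * r = P ^ k * (s + P ^ m * c)" by (simp add: power_add algebra_simps)
  then show "r = s + P ^ m * c" using P_nonzero by (metis mult_cancel_left power_not_zero)
qed

lemma pcong_cancel:
  assumes "pcong m (u * r) (u * s)" "inverse u \<in> Zp" "u \<noteq> 0"
  shows "pcong m r s"
  using pcong_mult_left [OF assms(2,1)] assms(3) by (simp flip: mult.assoc)

text \<open>The denominator of the witness is coprime to \<open>p ^ m\<close>, so it drops out of
  the divisibility.\<close>

lemma pcong_of_int_iff: "pcong m (of_int u) (of_int v) \<longleftrightarrow> int p ^ m dvd u - v"
proof
  assume "pcong m (of_int u) (of_int v)"
  then obtain a b where b: "\<not> int p dvd b" and "of_int u = of_int v + P ^ m * (of_int a / of_int b)"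
    unfolding pcong_def Zp_def by blast
  then have "of_int ((u - v) * b) = (of_int (int p ^ m * a) :: rat)"
    by (cases "b = 0") (auto simp: field_simps)
  then have "(u - v) * b = int p ^ m * a" by (simp only: of_int_eq_iff)
  then have "int p ^ m dvd (u - v) * b" by simp
  moreover have "coprime (int p ^ m) b"
    using b prime_int_p prime_imp_coprime by (intro coprime_power_left_iff [THEN iffD2]) blast
  ultimately show "int p ^ m dvd u - v" using coprime_dvd_mult_left_iff by blast
next
  assume "int p ^ m dvd u - v"
  then obtain c where "u - v = int p ^ m * c" by blast
  then have "of_int u - of_int v = P ^ m * of_int c"
    by (metis of_int_diff of_int_mult of_int_of_nat_eq of_int_power)
  then show "pcong m (of_int u) (of_int v)" by (rule pcongI) (rule Zp_of_int)
qed

text \<open>Any product of two or more corrections is divisible by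
  \<open>P ^ (2 * m)\<close>.\<close>

lemma pcong_prod_one_plus:
  assumes "finite I" "\<And>i. i \<in> I \<Longrightarrow> u i \<in> Zp"
  shows "pcong (2 * m) (\<Prod>i\<in>I. 1 + P ^ m * u i) (1 + P ^ m * (\<Sum>i\<in>I. u i))"
  using assms
proof (induction I)
  case empty
  show ?case by (simp add: pcong_refl)
next
  case (insert i I)
  have "pcong (2 * m) ((1 + P ^ m * u i) * (\<Prod>i\<in>I. 1 + P ^ m * u i)) ((1 + P ^ m * u i) * (1 + P ^ m * (\<Sum>i\<in>I. u i)))"
    using insert by (intro pcong_mult_left) (auto intro!: Zp_closed)
  moreover have "pcong (2 * m) ((1 + P ^ m * u i) * (1 + P ^ m * (\<Sum>i\<in>I. u i))) (1 + P ^ m * (u i + (\<Sum>i\<in>I. u i)))"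
    using insert
    by (intro pcongI [of _ _ _ "u i * (\<Sum>i\<in>I. u i)"])
       (auto simp: distrib_left distrib_right mult_2 power_add intro!: Zp_closed)
  ultimately show ?case using insert.hyps pcong_trans by auto
qed

section \<open>Integrality of \<open>s_lambda\<close> and its dependence on \<open>l\<close> modulo
  powers of \<open>p\<close>\<close>

lemma Zp_central_term: "k < p \<Longrightarrow> l \<in> Zp \<Longrightarrow> central_term k l \<in> Zp"
  unfolding central_term_def divide_inverse power_inverse [symmetric]
  by (intro Zp_closed Zp_inverse_fact)

lemma Zp_s_lambda: "n < p \<Longrightarrow> l \<in> Zp \<Longrightarrow> s_lambda n l \<in> Zp"
  unfolding s_lambda_def by (intro Zp_closed Zp_central_term) auto

lemma Zp_s_at: "n < p \<Longrightarrow> x \<in> Zp \<Longrightarrow> s_at n x \<in> Zp"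
  unfolding s_at_def by (intro Zp_s_lambda Zp_closed)

lemma pcong_central_term:
  assumes "k < p" "pcong m l l'" "l' \<in> Zp"
  shows "pcong m (central_term k l) (central_term k l')"
proof -
  let ?g = "\<lambda>l. \<Prod>i<k. l - of_nat i * (of_nat i + 1)"
  have "pcong m ((inverse (fact k))\<^sup>2 * ?g l) ((inverse (fact k))\<^sup>2 * ?g l')"
    using assms
    by (intro pcong_mult_left pcong_prod pcong_diff pcong_refl Zp_closed Zp_inverse_fact)
  then show ?thesis by (simp add: central_term_def divide_inverse mult.commute power_inverse)
qed

lemma choose_p_multiple:
  assumes "0 < k" "k < p"
  obtains c where "c \<in> Zp" "of_nat (p choose k) = P * c"
proof -
  have "p dvd p choose k" using assms prime_p by (intro dvd_choose_prime) auto
  then obtain c where "p choose k = p * c" by blast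
  then show ?thesis using that [of "of_nat c"] by (simp add: Zp_of_nat)
qed

text \<open>The last term stands apart because the square of \<open>fact p\<close> puts
  \<open>p\<close> squared into its denominator; the others have denominators prime to
  \<open>p\<close>.\<close>

lemma s_lambda_p_split: "s_lambda p l = (\<Sum>k<p. of_nat (p choose k) * central_term k l) + central_term p l"
  unfolding s_lambda_def by (simp flip: lessThan_Suc_atMost)

text \<open>A power of \<open>p\<close> is gained because \<open>p\<close> divides
  \<open>p choose k\<close> for \<open>0 < k < p\<close>, while the term \<open>k = 0\<close> is
  constant.\<close>

lemma pcong_s_lambda_p:
  assumes "pcong m l l'" "l' \<in> Zp"
  shows "pcong (Suc m) (s_lambda p l - central_term p l) (s_lambda p l' - central_term p l')"
proof -
  have "pcong (Suc m) (of_nat (p choose k) * central_term k l) (of_nat (p choose k) * central_term k l')" if "k < p" for k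
  proof (cases "k = 0")
    case True
    then show ?thesis by (simp add: pcong_refl)
  next
    case False
    then obtain c where c: "c \<in> Zp" "of_nat (p choose k) = P * c"
      using choose_p_multiple \<open>k < p\<close> by blast
    have "pcong (1 + m) (P ^ 1 * (c * central_term k l)) (P ^ 1 * (c * central_term k l'))"
      using c assms \<open>k < p\<close> by (intro pcong_scale pcong_mult_left pcong_central_term)
    then show ?thesis by (simp add: c mult.assoc)
  qed
  then show ?thesis unfolding s_lambda_p_split by (auto intro!: pcong_sum)
qed

section \<open>The polynomials \<open>s\<^sub>p\<close> and \<open>s\<^sub>p\<^sub>-\<^sub>1\<close>\<close>

lemma Zp_harmonic: "a < p \<Longrightarrow> harmonic a \<in> Zp"
  unfolding harmonic_def by (intro Zp_sum Zp_divide_of_nat Zp_1) auto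

text \<open>Both \<open>n = p\<close> (with \<open>e = 1\<close>) and \<open>n = p - 1\<close> (with \<open>e = -1\<close>) are instances.\<close>

lemma pcong_s_at_mod_square:
  assumes e: "e \<in> {1, -1}" and n: "2 * of_nat n + 1 = e + 2 * P" and "a < p"
  shows "pcong 2 (s_at n (of_nat a)) (e ^ a * (1 + 2 * e * P * harmonic a))"
  using \<open>a < p\<close>
proof (induction a rule: less_induct)
  case (less a)
  have eZ [intro, simp]: "e \<in> Zp" using e by (auto intro: Zp_closed)
  have ee: "e * e = 1" using e by auto
  then have ee': "e * (e * r) = r" for r by (simp flip: mult.assoc)
  show ?case
  proof (cases a)
    case 0
    then show ?thesis by (simp add: pcong_refl s_at_0)
  next
    case (Suc b)
    let ?b = "of_nat b :: rat"
    have b: "b < p" using less.prems Suc by simp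
    have hb [intro, simp]: "harmonic b \<in> Zp" using Zp_harmonic b by blast
    have rec: "(?b + 1)\<^sup>2 * s_at n (of_nat a) = (2 * ?b + 1) * (e + 2 * P) * s_at n ?b + ?b\<^sup>2 * s_at n (?b - 1)"
      using s_at_dual_recurrence [of ?b n] unfolding n by (simp add: Suc add.commute)
    have IH: "pcong 2 (s_at n ?b) (e ^ b * (1 + 2 * e * P * harmonic b))"
      using less.IH [of b] b Suc by simp
    \<comment> \<open>The factor \<open>?b\<^sup>2\<close> removes the value at \<open>-1\<close>
      when \<open>b = 0\<close>, and for \<open>b = Suc c\<close> it clears the denominator in
      \<open>harmonic c = harmonic b - 1 / b\<close>. The sign agrees because
      \<open>e * e = 1\<close>.\<close>
    have prev: "pcong 2 (?b\<^sup>2 * s_at n (?b - 1)) (e ^ Suc b * (?b\<^sup>2 + 2 * e * P * (?b\<^sup>2 * harmonic b - ?b)))"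
    proof (cases b)
      case 0
      then show ?thesis by (simp add: pcong_refl)
    next
      case (Suc c)
      then have "?b - 1 = of_nat c" by simp
      then have lt: "pcong 2 (?b\<^sup>2 * s_at n (?b - 1)) (?b\<^sup>2 * (e ^ c * (1 + 2 * e * P * harmonic c)))"
        using less.IH [of c] b \<open>a = Suc b\<close> Suc by (auto intro!: pcong_mult_left Zp_closed)
      have "harmonic b = harmonic c + 1 / ?b"
        using Suc by (simp add: harmonic_Suc add.commute)
      then have "?b\<^sup>2 * harmonic c = ?b\<^sup>2 * harmonic b - ?b"
        using Suc by (simp add: power2_eq_square distrib_left del: of_nat_Suc)
      moreover have "e ^ Suc b = e ^ c" using Suc ee by simp
      moreover have "?b\<^sup>2 * (e ^ c * (1 + 2 * e * P * harmonic c)) = e ^ c * (?b\<^sup>2 + 2 * e * P * (?b\<^sup>2 * harmonic c))"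
        by (simp add: algebra_simps)
      ultimately have "?b\<^sup>2 * (e ^ c * (1 + 2 * e * P * harmonic c)) = e ^ Suc b * (?b\<^sup>2 + 2 * e * P * (?b\<^sup>2 * harmonic b - ?b))"
        by simp
      with lt show ?thesis by simp
    qed
    have "pcong 2 ((?b + 1)\<^sup>2 * s_at n (of_nat a))
       ((2 * ?b + 1) * (e + 2 * P) * (e ^ b * (1 + 2 * e * P * harmonic b))
         + e ^ Suc b * (?b\<^sup>2 + 2 * e * P * (?b\<^sup>2 * harmonic b - ?b)))" (is "pcong 2 _ ?R")
      unfolding rec by (intro pcong_add pcong_mult_left IH prev Zp_closed eZ)
    also have "pcong 2 ?R ((?b + 1)\<^sup>2 * (e ^ a * (1 + 2 * e * P * harmonic a)))"
    proof (rule pcongI)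
      have "(?b + 1)\<^sup>2 * (1 / (?b + 1)) = ?b + 1" by (simp add: power2_eq_square)
      then have ha: "(?b + 1)\<^sup>2 * harmonic a = (?b + 1)\<^sup>2 * harmonic b + ?b + 1"
        unfolding Suc harmonic_Suc by (simp only: distrib_left add.assoc)
      have "(?b + 1)\<^sup>2 * (e ^ a * (1 + 2 * e * P * harmonic a))
         = e ^ a * ((?b + 1)\<^sup>2 + 2 * e * P * ((?b + 1)\<^sup>2 * harmonic a))"
        by (simp add: algebra_simps)
      then show "?R - (?b + 1)\<^sup>2 * (e ^ a * (1 + 2 * e * P * harmonic a))
          = P\<^sup>2 * (4 * (2 * ?b + 1) * e ^ Suc b * harmonic b)"
        unfolding ha by (simp add: Suc ee ee' power2_eq_square algebra_simps)
      show "4 * (2 * ?b + 1) * e ^ Suc b * harmonic b \<in> Zp"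
        by (intro Zp_closed eZ hb)
    qed
    \<comment> \<open>The recurrence is divided by \<open>(?b + 1)\<^sup>2\<close>, the square of
      \<open>a\<close>, which is a unit because \<open>0 < a < p\<close>.\<close>
    finally show ?thesis
    proof (rule pcong_cancel)
      have "inverse (of_nat a) \<in> Zp" using Zp_inverse_of_nat [of a] less.prems Suc by simp
      then show "inverse ((?b + 1)\<^sup>2) \<in> Zp"
        unfolding power_inverse [symmetric] using Suc by (auto intro!: Zp_power simp: add.commute)
    qed auto
  qed
qed

lemma pcong_s_at_p: "a < p \<Longrightarrow> pcong 2 (s_at p (of_nat a)) (1 + 2 * P * harmonic a)"
  using pcong_s_at_mod_square [of 1 p a] by simp

lemma pcong_s_at_pred_p: "a < p \<Longrightarrow> pcong 2 (s_at (p - 1) (of_nat a)) ((- 1) ^ a * (1 - 2 * P * harmonic a))"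
  using pcong_s_at_mod_square [of "- 1" "p - 1" a] p_gt_3 by (simp add: of_nat_diff)

section \<open>Harmonic sums modulo \<open>p\<close>\<close>

lemma pcong_inverse_reflect:
  assumes "0 < j" "j < p"
  shows "pcong 1 (1 / of_nat (p - j)) (- 1 / of_nat j)"
proof (rule pcongI)
  show "1 / of_nat (p - j) - (- 1 / of_nat j) = P ^ 1 * (inverse (of_nat (p - j)) * inverse (of_nat j))"
    using assms by (simp add: field_simps of_nat_diff)
  show "inverse (of_nat (p - j)) * inverse (of_nat j) \<in> Zp"
    using assms by (intro Zp_mult Zp_inverse_of_nat) auto
qed

text \<open>Replacing \<open>j\<close> by \<open>p - j\<close> shows that the sum is congruent to
  its own negative, and 2 is a unit.\<close>

lemma pcong_harmonic_pred_p: "pcong 1 (harmonic (p - 1)) 0"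
proof -
  have "harmonic (p - 1) = (\<Sum>j<p - 1. 1 / of_nat (p - Suc j))"
    unfolding harmonic_def by (rule sum.reindex_bij_witness [of _ "\<lambda>j. p - 2 - j" "\<lambda>j. p - 2 - j"]) auto
  moreover have "pcong 1 (\<Sum>j<p - 1. 1 / of_nat (p - Suc j)) (\<Sum>j<p - 1. - 1 / of_nat (Suc j))"
    by (intro pcong_sum pcong_inverse_reflect) auto
  ultimately have "pcong 1 (harmonic (p - 1)) (- harmonic (p - 1))"
    by (simp add: harmonic_def sum_negf)
  then have "pcong 1 (harmonic (p - 1) + harmonic (p - 1)) (- harmonic (p - 1) + harmonic (p - 1))"
    by (intro pcong_add pcong_refl)
  then have "pcong 1 (2 * harmonic (p - 1)) (2 * 0)" by simp
  then show ?thesis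
    by (rule pcong_cancel) (use Zp_inverse_of_nat [of 2] p_gt_3 in auto)
qed

text \<open>Dropping \<open>1 / (p - Suc a)\<close> on the left has the same effect modulo
  \<open>p\<close> as adding \<open>1 / Suc a\<close> on the right.\<close>

lemma pcong_harmonic_reflect: "a < p \<Longrightarrow> pcong 1 (harmonic (p - 1 - a)) (harmonic a)"
proof (induction a)
  case 0
  then show ?case using pcong_harmonic_pred_p by simp
next
  case (Suc a)
  have "p - 1 - a = Suc (p - 1 - Suc a)" using Suc.prems by simp
  then have "harmonic (p - 1 - a) = harmonic (p - 1 - Suc a) + 1 / of_nat (p - Suc a)"
    by (simp add: harmonic_def)
  then have "harmonic (p - 1 - Suc a) = harmonic (p - 1 - a) - 1 / of_nat (p - Suc a)" by simp
  moreover have "pcong 1 (harmonic (p - 1 - a) - 1 / of_nat (p - Suc a)) (harmonic a - (- 1 / of_nat (Suc a)))"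
    using Suc by (intro pcong_diff pcong_inverse_reflect) auto
  ultimately show ?case by (simp add: harmonic_def)
qed

section \<open>Binomial coefficients with lower entry \<open>p\<close>\<close>

lemma odd_p: "odd p"
  using prime_p p_gt_3 prime_odd_nat by auto

lemma fact_p: "fact p = P * fact (p - 1)"
  using p_gt_3 by (simp add: fact_reduce)

text \<open>The factor \<open>i = 0\<close> contributes \<open>P * t\<close>, whose \<open>P\<close>
  cancels against \<open>fact p\<close>. The others are \<open>- j * (1 - P * t / j)\<close>; their
  linear terms sum to a multiple of \<open>P * harmonic (p - 1)\<close>, which vanishes modulo
  \<open>p\<close> squared.\<close>

lemma pcong_gbinomial_p_multiple:
  assumes "t \<in> Zp"
  shows "pcong 2 ((P * t) gchoose p) t"
proof -
  let ?u = "\<lambda>j. - t / of_nat (Suc j)"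
  have "(\<Prod>i<p. P * t - of_nat i) = P * t * (\<Prod>j<p - 1. P * t - of_nat (Suc j))"
    using p_gt_3 prod.lessThan_Suc_shift [of "\<lambda>i. P * t - of_nat i" "p - 1"] by simp
  also have "(\<Prod>j<p - 1. P * t - of_nat (Suc j)) = (\<Prod>j<p - 1. - of_nat (Suc j) * (1 + P ^ 1 * ?u j))"
    by (rule prod.cong) (auto simp: field_simps simp del: of_nat_Suc)
  also have "\<dots> = (\<Prod>j<p - 1. - of_nat (Suc j)) * (\<Prod>j<p - 1. 1 + P ^ 1 * ?u j)"
    by (rule prod.distrib)
  also have "(\<Prod>j<p - 1. - of_nat (Suc j)) = (fact (p - 1) :: rat)"
    using odd_p p_gt_3
    by (simp add: prod_uminus fact_prod_Suc atLeast0LessThan del: of_nat_Suc)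
  finally have "(P * t) gchoose p = t * (\<Prod>j<p - 1. 1 + P ^ 1 * ?u j)"
    by (simp add: gbinomial_lessThan fact_p)
  moreover have "pcong (2 * 1) (t * (\<Prod>j<p - 1. 1 + P ^ 1 * ?u j)) (t * (1 + P ^ 1 * (\<Sum>j<p - 1. ?u j)))"
    using assms by (intro pcong_mult_left pcong_prod_one_plus Zp_divide_of_nat Zp_minus) auto
  moreover have "(\<Sum>j<p - 1. ?u j) = - t * harmonic (p - 1)"
    by (simp add: harmonic_def sum_distrib_left sum_negf del: of_nat_Suc)
  moreover have "pcong (1 + 1) (P ^ 1 * (- t * harmonic (p - 1))) (P ^ 1 * (- t * 0))"
    using assms by (intro pcong_scale pcong_mult_left pcong_harmonic_pred_p Zp_minus)
  then have "pcong 2 (t * (1 + P ^ 1 * (- t * harmonic (p - 1)))) (t * (1 + P ^ 1 * (- t * 0)))"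
    using assms by (intro pcong_mult_left [of t] pcong_add pcong_refl) (simp_all only: one_add_one)
  ultimately show ?thesis using pcong_trans by simp
qed

text \<open>Passing from \<open>a\<close> to \<open>a + 1\<close> multiplies the binomial by
  \<open>(a + 1 + P * t) / (a + 1 + P * (t - 1))\<close>. The denominator is a unit as
  \<open>a + 1 < p\<close>, and the ratio is \<open>1 + P / (a + 1)\<close> modulo \<open>p\<close>
  squared.\<close>

lemma pcong_gbinomial_p:
  assumes "a < p"
  shows "pcong 2 ((of_nat a + P * of_int t) gchoose p) (of_int t * (1 + P * harmonic a))"
  using assms
proof (induction a)
  case 0
  then show ?case using pcong_gbinomial_p_multiple [OF Zp_of_int] by simp
next
  case (Suc a)
  let ?x = "of_nat a + P * of_int t" and ?u = "of_nat a + 1 + P * (of_int t - 1)" and ?h = "harmonic a"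
  define y :: rat where "y = 1 / (of_nat a + 1)"
  have y: "(of_nat a + 1) * y = 1" "y \<in> Zp"
    using Suc.prems Zp_divide_of_nat [of "Suc a" 1] by (auto simp: y_def Zp_1 add.commute)
  have h: "?h \<in> Zp" using Suc.prems by (intro Zp_harmonic) simp
  have "?u * ((of_nat (Suc a) + P * of_int t) gchoose p) = (of_nat a + 1 + P * of_int t) * (?x gchoose p)"
    using gbinomial_upper_shift [of ?x p] by (simp add: algebra_simps)
  moreover have "pcong 2 ((of_nat a + 1 + P * of_int t) * (?x gchoose p)) ((of_nat a + 1 + P * of_int t) * (of_int t * (1 + P * ?h)))"
    using Suc by (intro pcong_mult_left Zp_closed) auto
  moreover have "pcong 2 ((of_nat a + 1 + P * of_int t) * (of_int t * (1 + P * ?h))) (?u * (of_int t * (1 + P * (?h + y))))"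
  proof (rule pcongI)
    have "?u * (of_int t * (1 + P * (?h + y))) = of_int t * (?u * (1 + P * ?h) + P * ((of_nat a + 1) * y) + P * P * (of_int t - 1) * y)"
      by (simp add: algebra_simps)
    then show "(of_nat a + 1 + P * of_int t) * (of_int t * (1 + P * ?h)) - ?u * (of_int t * (1 + P * (?h + y)))
        = P\<^sup>2 * (of_int t * (?h - (of_int t - 1) * y))"
      unfolding y(1) by (simp add: power2_eq_square algebra_simps)
    show "of_int t * (?h - (of_int t - 1) * y) \<in> Zp" by (intro Zp_closed h y)
  qed
  ultimately have "pcong 2 (?u * ((of_nat (Suc a) + P * of_int t) gchoose p)) (?u * (of_int t * (1 + P * (?h + y))))"
    using pcong_trans by simp
  moreover have u: "?u = of_int (int (Suc a) + int p * (t - 1))" by simp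
  moreover have nd: "\<not> int p dvd int (Suc a) + int p * (t - 1)"
  proof
    assume "int p dvd int (Suc a) + int p * (t - 1)"
    then have "int p dvd int (Suc a)" by (simp add: dvd_add_left_iff del: of_nat_Suc)
    then have "p dvd Suc a" by (simp only: int_dvd_int_iff)
    then show False using Suc.prems nat_dvd_not_less by blast
  qed
  then have "int (Suc a) + int p * (t - 1) \<noteq> 0" by auto
  ultimately have "pcong 2 (((of_nat (Suc a) + P * of_int t) gchoose p)) (of_int t * (1 + P * (?h + y)))"
    using Zp_inverse_of_int [OF nd] pcong_cancel by (metis of_int_eq_0_iff)
  then show ?case by (simp add: harmonic_Suc y_def)
qed

text \<open>The second binomial has upper entry \<open>x + P\<close>, that is, the same
  \<open>a\<close> with \<open>t + 1\<close> for \<open>t\<close>.\<close>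

lemma pcong_central_term_p:
  assumes "a < p" "x = of_nat a + P * of_int t"
  shows "pcong 2 (central_term p (x * (x + 1))) (of_int t * (of_int t + 1) * (1 + 2 * P * harmonic a))"
proof -
  have h: "harmonic a \<in> Zp" using assms Zp_harmonic by blast
  have x: "x + P = of_nat a + P * of_int (t + 1)" using assms by (simp add: algebra_simps)
  have "pcong 2 (central_term p (x * (x + 1))) (of_int t * (1 + P * harmonic a) * (of_int (t + 1) * (1 + P * harmonic a)))"
    unfolding central_term_gbinomial x unfolding assms
    by (intro pcong_mult pcong_gbinomial_p assms Zp_closed h)
  also have "pcong 2 (of_int t * (1 + P * harmonic a) * (of_int (t + 1) * (1 + P * harmonic a)))
     (of_int t * (of_int t + 1) * (1 + 2 * P * harmonic a))"
    by (rule pcongI [of _ _ _ "of_int t * (of_int t + 1) * (harmonic a)\<^sup>2"])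
       (auto simp: power2_eq_square algebra_simps intro!: Zp_closed h)
  finally show ?thesis .
qed

text \<open>The first two terms of a Taylor expansion in \<open>p\<^sup>m t\<close>, uniformly in \<open>t\<close>.\<close>

definition linear_mod :: "nat \<Rightarrow> (rat \<Rightarrow> rat) \<Rightarrow> bool" where
  "linear_mod m f \<longleftrightarrow> (\<exists>\<alpha>\<in>Zp. \<exists>\<beta>\<in>Zp. \<forall>t\<in>Zp. pcong (2 * m) (f t) (\<alpha> + P ^ m * \<beta> * t))"

lemma linear_mod_const: "c \<in> Zp \<Longrightarrow> linear_mod m (\<lambda>t. c)"
  unfolding linear_mod_def by (rule bexI [of _ c], rule bexI [of _ 0]) (auto intro: Zp_0 pcong_refl)

lemma linear_mod_add:
  assumes "linear_mod m f" "linear_mod m g"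
  shows "linear_mod m (\<lambda>t. f t + g t)"
proof -
  obtain a b c d where *: "a \<in> Zp" "b \<in> Zp" "c \<in> Zp" "d \<in> Zp"
    "\<forall>t\<in>Zp. pcong (2 * m) (f t) (a + P ^ m * b * t)" "\<forall>t\<in>Zp. pcong (2 * m) (g t) (c + P ^ m * d * t)"
    using assms unfolding linear_mod_def by blast
  have "pcong (2 * m) (f t + g t) ((a + c) + P ^ m * (b + d) * t)" if "t \<in> Zp" for t
    using pcong_add [of "2 * m" "f t" _ "g t"] * that by (fastforce simp: algebra_simps)
  then show ?thesis unfolding linear_mod_def using * Zp_add by blast
qed

lemma linear_mod_mult:
  assumes "linear_mod m f" "linear_mod m g"
  shows "linear_mod m (\<lambda>t. f t * g t)"
proof -
  obtain a b c d where *: "a \<in> Zp" "b \<in> Zp" "c \<in> Zp" "d \<in> Zp"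
    "\<forall>t\<in>Zp. pcong (2 * m) (f t) (a + P ^ m * b * t)" "\<forall>t\<in>Zp. pcong (2 * m) (g t) (c + P ^ m * d * t)"
    using assms unfolding linear_mod_def by blast
  have "pcong (2 * m) (f t * g t) (a * c + P ^ m * (a * d + b * c) * t)" if t: "t \<in> Zp" for t
  proof -
    have sq: "P ^ (2 * m) = P ^ m * P ^ m" by (simp add: mult_2 power_add)
    have "pcong (2 * m) (f t * g t) ((a + P ^ m * b * t) * (c + P ^ m * d * t))"
      using * t by (intro pcong_mult Zp_closed) auto
    also have "pcong (2 * m) \<dots> (a * c + P ^ m * (a * d + b * c) * t)"
    proof (rule pcongI)
      show "(a + P ^ m * b * t) * (c + P ^ m * d * t) - (a * c + P ^ m * (a * d + b * c) * t)
          = P ^ (2 * m) * (b * d * t * t)"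
        unfolding sq by (simp add: algebra_simps)
      show "b * d * t * t \<in> Zp" by (intro Zp_closed * t)
    qed
    finally show ?thesis .
  qed
  moreover have "a * c \<in> Zp" "a * d + b * c \<in> Zp" using * by (auto intro!: Zp_closed)
  ultimately show ?thesis unfolding linear_mod_def by blast
qed

text \<open>One more Taylor term is kept, since the modulus is \<open>p\<close> cubed while the step
  is only \<open>p\<close>.\<close>

definition quadratic_mod :: "(rat \<Rightarrow> rat) \<Rightarrow> bool" where
  "quadratic_mod f \<longleftrightarrow> (\<exists>\<alpha>\<in>Zp. \<exists>\<beta>\<in>Zp. \<exists>\<gamma>\<in>Zp. \<forall>t\<in>Zp. pcong 3 (f t) (\<alpha> + P * \<beta> * t + P\<^sup>2 * \<gamma> * t\<^sup>2))"

lemma quadratic_mod_const: "c \<in> Zp \<Longrightarrow> quadratic_mod (\<lambda>t. c)"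
  unfolding quadratic_mod_def
  by (rule bexI [of _ c], rule bexI [of _ 0], rule bexI [of _ 0]) (auto intro: Zp_0 pcong_refl)

lemma quadratic_mod_add:
  assumes "quadratic_mod f" "quadratic_mod g"
  shows "quadratic_mod (\<lambda>t. f t + g t)"
proof -
  obtain a b e c d h where *: "a \<in> Zp" "b \<in> Zp" "c \<in> Zp" "d \<in> Zp" "e \<in> Zp" "h \<in> Zp"
    "\<forall>t\<in>Zp. pcong 3 (f t) (a + P * b * t + P\<^sup>2 * e * t\<^sup>2)" "\<forall>t\<in>Zp. pcong 3 (g t) (c + P * d * t + P\<^sup>2 * h * t\<^sup>2)"
    using assms unfolding quadratic_mod_def by blast
  have "pcong 3 (f t + g t) ((a + c) + P * (b + d) * t + P\<^sup>2 * (e + h) * t\<^sup>2)" if "t \<in> Zp" for t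
    using pcong_add [of 3 "f t" _ "g t"] * that by (fastforce simp: algebra_simps)
  then show ?thesis unfolding quadratic_mod_def using * Zp_add by blast
qed

lemma quadratic_mod_mult:
  assumes "quadratic_mod f" "quadratic_mod g"
  shows "quadratic_mod (\<lambda>t. f t * g t)"
proof -
  obtain a b e c d h where *: "a \<in> Zp" "b \<in> Zp" "c \<in> Zp" "d \<in> Zp" "e \<in> Zp" "h \<in> Zp"
    "\<forall>t\<in>Zp. pcong 3 (f t) (a + P * b * t + P\<^sup>2 * e * t\<^sup>2)" "\<forall>t\<in>Zp. pcong 3 (g t) (c + P * d * t + P\<^sup>2 * h * t\<^sup>2)"
    using assms unfolding quadratic_mod_def by blast
  have "pcong 3 (f t * g t) (a * c + P * (a * d + b * c) * t + P\<^sup>2 * (a * h + b * d + e * c) * t\<^sup>2)"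
    if t: "t \<in> Zp" for t
  proof -
    have "pcong 3 (f t * g t) ((a + P * b * t + P\<^sup>2 * e * t\<^sup>2) * (c + P * d * t + P\<^sup>2 * h * t\<^sup>2))"
      using * t by (intro pcong_mult Zp_closed) auto
    also have "pcong 3 \<dots> (a * c + P * (a * d + b * c) * t + P\<^sup>2 * (a * h + b * d + e * c) * t\<^sup>2)"
      by (rule pcongI [of _ _ _ "(b * h + e * d) * t ^ 3 + P * e * h * t ^ 4"])
         (auto simp: power2_eq_square power3_eq_cube power4_eq_xxxx distrib_left distrib_right mult_ac intro!: Zp_closed * t)
    finally show ?thesis .
  qed
  moreover have "a * c \<in> Zp" "a * d + b * c \<in> Zp" "a * h + b * d + e * c \<in> Zp" using * by (auto intro!: Zp_closed)
  ultimately show ?thesis unfolding quadratic_mod_def by blast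
qed

text \<open>For \<open>n < p\<close> the polynomial \<open>s_lambda n\<close> has coefficients in
  \<open>Zp\<close>, so it preserves every class of functions containing the constants and closed
  under sums and products. Leaving \<open>Q\<close> abstract covers linear and quadratic expansions
  at once.\<close>

lemma s_lambda_closure:
  assumes const: "\<And>c. c \<in> Zp \<Longrightarrow> Q (\<lambda>t. c)"
    and add: "\<And>f g. Q f \<Longrightarrow> Q g \<Longrightarrow> Q (\<lambda>t :: rat. f t + g t)"
    and mult: "\<And>f g. Q f \<Longrightarrow> Q g \<Longrightarrow> Q (\<lambda>t. f t * g t)"
    and L: "Q L" and n: "n < p"
  shows "Q (\<lambda>t. s_lambda n (L t))"
proof -
  have prod: "Q (\<lambda>t. \<Prod>i<k. f i t)" if "\<And>i. Q (f i)" for f and k :: nat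
    by (induction k) (use that const [OF Zp_1] mult in auto)
  have sum: "Q (\<lambda>t. \<Sum>i<k. f i t)" if "\<And>i. i < k \<Longrightarrow> Q (f i)" for f and k :: nat
    using that by (induction k) (use const [OF Zp_0] add in auto)
  have "Q (\<lambda>t. of_nat (n choose k) * central_term k (L t))" if "k < Suc n" for k
  proof -
    have "Q (\<lambda>t. L t + - (of_nat i * (of_nat i + 1)))" for i
      by (intro add L const Zp_closed)
    then have "Q (\<lambda>t. \<Prod>i<k. L t - of_nat i * (of_nat i + 1))" by (intro prod) simp
    then have "Q (\<lambda>t. of_nat (n choose k) * ((\<Prod>i<k. L t - of_nat i * (of_nat i + 1)) * (inverse (fact k))\<^sup>2))"
      using that n by (intro mult const Zp_closed Zp_inverse_fact) auto
    then show ?thesis by (simp add: central_term_def divide_inverse power_inverse)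
  qed
  then show ?thesis
    unfolding s_lambda_def lessThan_Suc_atMost [symmetric] by (intro sum)
qed


lemma linear_mod_s_at:
  assumes "n < p" "x \<in> Zp"
  shows "linear_mod 1 (\<lambda>t. s_at n (x + P * t))"
  unfolding s_at_def
proof (rule s_lambda_closure [OF linear_mod_const linear_mod_add linear_mod_mult])
  have "linear_mod 1 (\<lambda>t. x + P * t)"
    unfolding linear_mod_def using assms
    by (intro bexI [of _ x] bexI [of _ 1]) (auto intro!: pcong_refl Zp_1)
  moreover from this have "linear_mod 1 (\<lambda>t. x + P * t + 1)"
    by (rule linear_mod_add [OF _ linear_mod_const]) (rule Zp_1)
  ultimately show "linear_mod 1 (\<lambda>t. (x + P * t) * (x + P * t + 1))" by (rule linear_mod_mult)
qed (use assms in auto)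

lemma quadratic_mod_s_at:
  assumes "n < p" "x \<in> Zp"
  shows "quadratic_mod (\<lambda>t. s_at n (x + P * t))"
  unfolding s_at_def
proof (rule s_lambda_closure [OF quadratic_mod_const quadratic_mod_add quadratic_mod_mult])
  have "quadratic_mod (\<lambda>t. x + P * t)"
    unfolding quadratic_mod_def using assms
    by (intro bexI [of _ x] bexI [of _ 1] bexI [of _ 0]) (auto intro!: pcong_refl Zp_1 Zp_0)
  moreover from this have "quadratic_mod (\<lambda>t. x + P * t + 1)"
    by (rule quadratic_mod_add [OF _ quadratic_mod_const]) (rule Zp_1)
  ultimately show "quadratic_mod (\<lambda>t. (x + P * t) * (x + P * t + 1))" by (rule quadratic_mod_mult)
qed (use assms in auto)

section \<open>Values of \<open>s_at (p - 1)\<close> and \<open>s_at p\<close> on a whole residue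
  class\<close>

lemma minus_one_power_reflect:
  assumes "a < p"
  shows "(- 1 :: rat) ^ (p - 1 - a) = (- 1) ^ a"
proof -
  have "even (p - 1 - a) \<longleftrightarrow> even a" using odd_p assms by auto
  then show ?thesis by (simp add: minus_one_power_iff)
qed

text \<open>Modulo \<open>p\<close> squared the value is linear in \<open>t\<close>. At
  \<open>t = -1\<close> the argument is \<open>a - p = - 1 - (p - 1 - a)\<close>, so reflection and
  the symmetry of \<open>harmonic\<close> give the same value as at \<open>t = 0\<close>. Hence the
  slope vanishes.\<close>

lemma pcong_s_at_pred_p_const:
  assumes "a < p" "t \<in> Zp"
  shows "pcong 2 (s_at (p - 1) (of_nat a + P * t)) ((- 1) ^ a * (1 - 2 * P * harmonic a))"
    (is "pcong 2 _ ?S")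
proof -
  obtain \<alpha> \<beta> where ab: "\<alpha> \<in> Zp" "\<beta> \<in> Zp"
    and lin: "\<And>t. t \<in> Zp \<Longrightarrow> pcong 2 (s_at (p - 1) (of_nat a + P * t)) (\<alpha> + P * \<beta> * t)"
    using linear_mod_s_at [of "p - 1" "of_nat a"] p_gt_3 Zp_of_nat unfolding linear_mod_def by auto
  have a0: "pcong 2 \<alpha> ?S"
    using pcong_trans [OF pcong_sym [OF lin [OF Zp_0]]] pcong_s_at_pred_p [OF assms(1)] by simp
  have "of_nat a + P * (- 1) = - 1 - of_nat (p - 1 - a)" using assms(1) by (simp add: of_nat_diff)
  then have reflect: "s_at (p - 1) (of_nat a + P * (- 1)) = s_at (p - 1) (of_nat (p - 1 - a))"
    by (simp only: s_at_reflect)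
  have "pcong 2 (s_at (p - 1) (of_nat (p - 1 - a))) ((- 1) ^ a * (1 - 2 * P * harmonic (p - 1 - a)))"
    using pcong_s_at_pred_p [of "p - 1 - a"] minus_one_power_reflect [OF assms(1)] assms(1) by simp
  also have "pcong 2 ((- 1) ^ a * (1 - 2 * P * harmonic (p - 1 - a))) ?S"
  proof -
    have "pcong (1 + 1) (P ^ 1 * harmonic (p - 1 - a)) (P ^ 1 * harmonic a)"
      using assms by (intro pcong_scale pcong_harmonic_reflect)
    then have "pcong 2 (P * harmonic (p - 1 - a)) (P * harmonic a)" by (simp add: numeral_2_eq_2)
    then have "pcong 2 (2 * (P * harmonic (p - 1 - a))) (2 * (P * harmonic a))"
      by (rule pcong_mult_left [OF Zp_numeral])
    then show ?thesis
      unfolding mult.assoc by (intro pcong_mult_left [of "(- 1) ^ a"] pcong_diff pcong_refl Zp_closed)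
  qed
  finally have "pcong 2 (s_at (p - 1) (of_nat a + P * (- 1))) ?S" unfolding reflect .
  with lin [OF Zp_minus [OF Zp_1]] have "pcong 2 (\<alpha> + P * \<beta> * (- 1)) ?S"
    using pcong_trans pcong_sym by blast
  with a0 have "pcong 2 (\<alpha> - (\<alpha> + P * \<beta> * (- 1))) (?S - ?S)" by (intro pcong_diff)
  then have "pcong 2 (t * (P * \<beta>)) (t * 0)" using assms by (intro pcong_mult_left) auto
  then have "pcong 2 (\<alpha> + P * \<beta> * t) (?S + 0)" using a0 by (intro pcong_add) (simp_all add: mult_ac)
  from pcong_trans [OF lin [OF assms(2)] this] show ?thesis by simp
qed

text \<open>Since \<open>x * (x + 1)\<close> moves by a multiple of \<open>p\<close>, only
  \<open>central_term p\<close> changes modulo \<open>p\<close> squared; at \<open>a\<close> itself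
  it is zero because of its factor \<open>i = a\<close>.\<close>

lemma pcong_s_at_p_multiple:
  assumes "a < p" "x = of_nat a + P * of_int t"
  shows "pcong 2 (s_at p x) (s_at p (of_nat a) + of_int t * (of_int t + 1) * (1 + 2 * P * harmonic a))"
proof -
  have "central_term p (of_nat a * (of_nat a + 1)) = 0"
    unfolding central_term_def using assms(1) by (auto intro!: prod_zero)
  moreover have "pcong 1 (x * (x + 1)) (of_nat a * (of_nat a + 1))"
    unfolding assms by (rule pcongI [of _ _ _ "of_int t * (2 * of_nat a + 1 + P * of_int t)"])
      (auto simp: algebra_simps intro!: Zp_closed)
  then have "pcong 2 (s_lambda p (x * (x + 1)) - central_term p (x * (x + 1)))
      (s_lambda p (of_nat a * (of_nat a + 1)) - central_term p (of_nat a * (of_nat a + 1)))"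
    using pcong_s_lambda_p [of 1] by (auto simp: numeral_2_eq_2 intro!: Zp_closed)
  ultimately have "pcong 2 (s_at p x - central_term p (x * (x + 1))) (s_at p (of_nat a))"
    by (simp add: s_at_def)
  from pcong_add [OF this pcong_central_term_p [OF assms]] show ?thesis by simp
qed

section \<open>Interpolation of the diagonal\<close>

lemma christoffel_darboux_p:
  "(l - m) * (\<Sum>n<p. s_lambda n l * s_lambda n m)
     = P\<^sup>2 * (s_lambda p l * s_lambda (p - 1) m - s_lambda (p - 1) l * s_lambda p m)"
proof -
  have "Suc (p - 1) = p" "of_nat (p - 1) + 1 = P" using p_gt_3 by (simp_all add: of_nat_diff)
  then show ?thesis using christoffel_darboux [of l m "p - 1"] by simp
qed

text \<open>The two values of \<open>l\<close> differ by \<open>2 * P * d * (2 * x + 1)\<close>.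
  Cancelling one \<open>P\<close> in Christoffel--Darboux leaves \<open>P\<close> times a
  determinant, so knowing the determinant modulo \<open>p\<close> squared suffices.\<close>

lemma pcong_sum_s_at_spread:
  assumes a: "a < p" and x: "x = of_nat a + P * of_int t" and d: "0 < d" "2 * d < p"
  shows "pcong 3 ((2 * x + 1) * (\<Sum>n<p. s_at n (x + P * of_nat d) * s_at n (x - P * of_nat d)))
    ((- 1) ^ a * P * (2 * of_int t + 1))"
proof -
  let ?d = "of_nat d :: rat" and ?h = "harmonic a"
  let ?x = "x + P * ?d" and ?y = "x - P * ?d"
  let ?S = "(- 1) ^ a * (1 - 2 * P * ?h)" and ?A = "s_at p (of_nat a)"
  let ?E = "\<lambda>t :: int. of_int t * (of_int t + 1) * (1 + 2 * P * ?h)"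
  define G where "G = (\<Sum>n<p. s_at n ?x * s_at n ?y)"
  have h: "?h \<in> Zp" using a Zp_harmonic by blast
  have A: "?A \<in> Zp" using pcong_in_Zp [OF pcong_s_at_p [OF a]] h by (auto intro!: Zp_closed)
  have xx: "?x = of_nat a + P * of_int (t + int d)" and yy: "?y = of_nat a + P * of_int (t - int d)"
    using x by (simp_all add: algebra_simps)
  have "(2 * P * ?d * (2 * x + 1)) * G = P\<^sup>2 * (s_at p ?x * s_at (p - 1) ?y - s_at (p - 1) ?x * s_at p ?y)"
    using christoffel_darboux_p [of "?x * (?x + 1)" "?y * (?y + 1)"]
    unfolding G_def s_at_def by (simp add: algebra_simps)
  then have "P * ((2 * ?d) * ((2 * x + 1) * G))
      = P * (P * (s_at p ?x * s_at (p - 1) ?y - s_at (p - 1) ?x * s_at p ?y))"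
    by (simp add: power2_eq_square mult_ac)
  then have G: "(2 * ?d) * ((2 * x + 1) * G) = P ^ 1 * (s_at p ?x * s_at (p - 1) ?y - s_at (p - 1) ?x * s_at p ?y)"
    by simp
  have "pcong 2 (s_at p ?x * s_at (p - 1) ?y - s_at (p - 1) ?x * s_at p ?y)
      ((?A + ?E (t + int d)) * ?S - ?S * (?A + ?E (t - int d)))"
    unfolding xx yy
    by (intro pcong_diff pcong_mult pcong_s_at_p_multiple pcong_s_at_pred_p_const a refl Zp_closed h A)
  \<comment> \<open>The unknown \<open>?A\<close> cancels, \<open>(t + d) * (t + d + 1) - (t - d) *
    (t - d + 1) = 2 * d * (2 * t + 1)\<close>, and
    \<open>(1 + 2 * P * ?h) * (1 - 2 * P * ?h)\<close> is 1 modulo \<open>p\<close> squared.\<close>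
  also have "pcong 2 \<dots> ((2 * ?d) * ((- 1) ^ a * (2 * of_int t + 1)))"
    by (rule pcongI [of _ _ _ "- 4 * (- 1) ^ a * ?h\<^sup>2 * (2 * ?d) * (2 * of_int t + 1)"])
       (simp add: power2_eq_square algebra_simps, intro Zp_closed h)
  finally have "pcong (1 + 2) ((2 * ?d) * ((2 * x + 1) * G)) (P ^ 1 * ((2 * ?d) * ((- 1) ^ a * (2 * of_int t + 1))))"
    unfolding G by (rule pcong_scale)
  then have "pcong 3 ((2 * ?d) * ((2 * x + 1) * G)) ((2 * ?d) * ((- 1) ^ a * P * (2 * of_int t + 1)))"
    by (simp add: mult_ac numeral_3_eq_3)
  then show ?thesis unfolding G_def
  proof (rule pcong_cancel)
    show "inverse (2 * ?d) \<in> Zp" using Zp_inverse_of_nat [of "2 * d"] d by simp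
    show "2 * ?d \<noteq> 0" using d by simp
  qed
qed

text \<open>For a quadratic \<open>q\<close> the product \<open>q t * q (- t)\<close> is even in
  \<open>t\<close>. The weights 4 and -1 at \<open>t = 1\<close> and \<open>t = 2\<close> add up to
  3 and cancel the \<open>t\<^sup>2\<close> term; the \<open>t ^ 4\<close> term already carries
  \<open>P ^ 4\<close>.\<close>

lemma pcong_sum_s_at_interpolate:
  assumes "x \<in> Zp"
  shows "pcong 3 (3 * (\<Sum>n<p. (s_at n x)\<^sup>2))
    (4 * (\<Sum>n<p. s_at n (x + P) * s_at n (x - P)) - (\<Sum>n<p. s_at n (x + P * 2) * s_at n (x - P * 2)))"
proof -
  have "pcong 3 (3 * (s_at n x)\<^sup>2) (4 * (s_at n (x + P) * s_at n (x - P)) - s_at n (x + P * 2) * s_at n (x - P * 2))"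
    if n: "n < p" for n
  proof -
    obtain a b c where abc: "a \<in> Zp" "b \<in> Zp" "c \<in> Zp"
      and quad: "\<And>t. t \<in> Zp \<Longrightarrow> pcong 3 (s_at n (x + P * t)) (a + P * b * t + P\<^sup>2 * c * t\<^sup>2)"
      using quadratic_mod_s_at [OF n assms] unfolding quadratic_mod_def by blast
    let ?q = "\<lambda>t. a + P * b * t + P\<^sup>2 * c * t\<^sup>2"
    have q: "?q t \<in> Zp" if "t \<in> Zp" for t using that abc by (auto intro!: Zp_closed)
    have two: "pcong 3 (s_at n (x + P * t) * s_at n (x - P * t)) (?q t * ?q (- t))" if "t \<in> Zp" for t
      using quad [OF that] quad [OF Zp_minus [OF that]] q [OF that] q [OF Zp_minus [OF that]]
      by (intro pcong_mult) auto
    have "pcong 3 (3 * (s_at n x)\<^sup>2) (3 * (?q 0 * ?q 0))"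
      using quad [OF Zp_0] q [OF Zp_0] unfolding power2_eq_square
      by (intro pcong_mult_left pcong_mult Zp_closed abc) auto
    also have "pcong 3 \<dots> (4 * (?q 1 * ?q (- 1)) - ?q 2 * ?q (- 2))"
      by (rule pcongI [of _ _ _ "12 * P * c\<^sup>2"])
         (simp add: power2_eq_square power3_eq_cube algebra_simps, intro Zp_closed abc)
    also have "pcong 3 \<dots> (4 * (s_at n (x + P) * s_at n (x - P)) - s_at n (x + P * 2) * s_at n (x - P * 2))"
      using two [OF Zp_1] two [of 2, OF Zp_numeral]
      by (intro pcong_diff pcong_mult_left Zp_closed) (auto intro: pcong_sym)
    finally show ?thesis .
  qed
  then show ?thesis
    unfolding sum_distrib_left sum_subtractf [symmetric] by (intro pcong_sum) auto
qed

text \<open>Both off-diagonal sums have the same value \<open>?R\<close>, so the interpolation reads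
  \<open>4 * ?R - ?R\<close>, and 3 is a unit.\<close>

theorem pcong_sum_s_at_squares:
  assumes a: "a < p" and x: "x = of_nat a + P * of_int t"
  shows "pcong 3 ((2 * x + 1) * (\<Sum>n<p. (s_at n x)\<^sup>2)) ((- 1) ^ a * P * (2 * of_int t + 1))"
    (is "pcong 3 _ ?R")
proof -
  have xZ: "x \<in> Zp" unfolding x by (intro Zp_closed)
  let ?G = "\<lambda>d. \<Sum>n<p. s_at n (x + P * d) * s_at n (x - P * d)"
  have "pcong 3 ((2 * x + 1) * (3 * (\<Sum>n<p. (s_at n x)\<^sup>2))) ((2 * x + 1) * (4 * ?G 1 - ?G 2))"
    using pcong_sum_s_at_interpolate [OF xZ] by (intro pcong_mult_left Zp_closed xZ) simp
  also have "(2 * x + 1) * (4 * ?G 1 - ?G 2) = 4 * ((2 * x + 1) * ?G 1) - (2 * x + 1) * ?G 2"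
    by (simp add: algebra_simps)
  also have "pcong 3 \<dots> (4 * ?R - ?R)"
  proof (intro pcong_diff pcong_mult_left Zp_closed)
    \<comment> \<open>The spread \<open>d = 2\<close> requires \<open>4 < p\<close>.\<close>
    have "p \<noteq> 4" using odd_p by auto
    then have "2 * 1 < p" "2 * 2 < p" using p_gt_3 by auto
    then show "pcong 3 ((2 * x + 1) * ?G 1) ?R" "pcong 3 ((2 * x + 1) * ?G 2) ?R"
      using pcong_sum_s_at_spread [OF a x, of 1] pcong_sum_s_at_spread [OF a x, of 2] by simp_all
  qed
  finally have "pcong 3 (3 * ((2 * x + 1) * (\<Sum>n<p. (s_at n x)\<^sup>2))) (3 * ?R)"
    by (simp add: algebra_simps)
  then show ?thesis
    by (rule pcong_cancel) (use Zp_inverse_of_nat [of 3] p_gt_3 in auto)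
qed

section \<open>The residue class of \<open>-1/2\<close>\<close>

lemma pcong_inverse_square_reflect:
  assumes "0 < j" "j < p"
  shows "pcong 1 ((1 / of_nat (p - j))\<^sup>2) ((1 / of_nat j)\<^sup>2)"
proof -
  have "- 1 / of_nat j \<in> Zp" using assms by (intro Zp_divide_of_nat Zp_minus Zp_1)
  then have "pcong 1 (1 / of_nat (p - j) * (1 / of_nat (p - j))) (- 1 / of_nat j * (- 1 / of_nat j))"
    using assms by (intro pcong_mult pcong_inverse_reflect)
  then show ?thesis by (simp add: power2_eq_square)
qed

text \<open>The full sum up to \<open>p - 1\<close> is evaluated twice. Reflecting the upper half
  gives \<open>2 * ?Y\<close>; reflecting the odd denominators to even ones gives
  \<open>?Y / 2\<close>. Hence \<open>3 * ?Y\<close> vanishes modulo \<open>p\<close>.\<close>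

lemma pcong_harmonic2_half:
  assumes b: "p = 2 * b + 1"
  shows "pcong 1 (harmonic2 b) 0"
proof -
  let ?g = "\<lambda>j. (1 / of_nat (Suc j) :: rat)\<^sup>2" and ?Y = "harmonic2 b"
  have Y: "?Y \<in> Zp"
    unfolding harmonic2_def using b by (intro Zp_sum Zp_power Zp_divide_of_nat Zp_1) auto
  have "(\<Sum>j<2 * b. ?g j) = (\<Sum>j<b. ?g j) + (\<Sum>j=b..<2 * b. ?g j)"
    by (simp add: sum.atLeastLessThan_concat flip: atLeast0LessThan)
  also have "(\<Sum>j=b..<2 * b. ?g j) = (\<Sum>j<b. (1 / of_nat (p - Suc j))\<^sup>2)"
    by (rule sum.reindex_bij_witness [of _ "\<lambda>j. 2 * b - 1 - j" "\<lambda>j. 2 * b - 1 - j"])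
       (auto simp: b Suc_diff_Suc simp del: of_nat_Suc)
  finally have Z1: "(\<Sum>j<2 * b. ?g j) = ?Y + (\<Sum>j<b. (1 / of_nat (p - Suc j))\<^sup>2)"
    by (simp add: harmonic2_def)
  have "pcong 1 (?Y + (\<Sum>j<b. (1 / of_nat (p - Suc j))\<^sup>2)) (?Y + (\<Sum>j<b. ?g j))"
    using b by (intro pcong_add pcong_refl pcong_sum pcong_inverse_square_reflect) auto
  then have 1: "pcong 1 (\<Sum>j<2 * b. ?g j) (2 * ?Y)" unfolding Z1 by (simp add: harmonic2_def)
  have even: "(1 / of_nat (2 * Suc j))\<^sup>2 = inverse 4 * ?g j" for j
    unfolding of_nat_mult by (simp add: power2_eq_square del: of_nat_Suc)
  have "(\<Sum>j<2 * b. ?g j) = (\<Sum>j<b. (1 / of_nat (2 * j + 1))\<^sup>2) + (\<Sum>j<b. (1 / of_nat (2 * Suc j))\<^sup>2)"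
    unfolding sum_split_parity sum.distrib by simp
  also have "(\<Sum>j<b. (1 / of_nat (2 * j + 1))\<^sup>2 :: rat) = (\<Sum>j<b. (1 / of_nat (p - 2 * Suc j))\<^sup>2)"
    by (rule sum.reindex_bij_witness [of _ "\<lambda>j. b - 1 - j" "\<lambda>j. b - 1 - j"])
       (auto simp: b intro!: arg_cong [of _ _ "\<lambda>n. (1 / of_nat n :: rat)\<^sup>2"])
  finally have Z2: "(\<Sum>j<2 * b. ?g j) = (\<Sum>j<b. (1 / of_nat (p - 2 * Suc j))\<^sup>2) + (\<Sum>j<b. (1 / of_nat (2 * Suc j))\<^sup>2)" .
  have "pcong 1 ((\<Sum>j<b. (1 / of_nat (p - 2 * Suc j))\<^sup>2) + (\<Sum>j<b. (1 / of_nat (2 * Suc j))\<^sup>2))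
      ((\<Sum>j<b. (1 / of_nat (2 * Suc j))\<^sup>2) + (\<Sum>j<b. (1 / of_nat (2 * Suc j))\<^sup>2))"
    using b by (intro pcong_add pcong_refl pcong_sum pcong_inverse_square_reflect) auto
  then have 2: "pcong 1 (\<Sum>j<2 * b. ?g j) (inverse 4 * ?Y + inverse 4 * ?Y)"
    unfolding Z2 [symmetric] unfolding even sum_distrib_left [symmetric] harmonic2_def .
  have "pcong 1 (2 * ?Y) (inverse 4 * ?Y + inverse 4 * ?Y)"
    using pcong_trans [OF pcong_sym [OF 1] 2] .
  then have "pcong 1 (2 * (2 * ?Y) - ?Y) (2 * (inverse 4 * ?Y + inverse 4 * ?Y) - ?Y)"
    by (intro pcong_diff pcong_refl pcong_mult_left [of 2] Zp_numeral)
  then have "pcong 1 (3 * ?Y) (3 * 0)" by simp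
  then show ?thesis
    by (rule pcong_cancel) (use Zp_inverse_of_nat [of 3] p_gt_3 in auto)
qed

section \<open>Diagonal values at integers modulo the fourth power of \<open>p\<close>\<close>

definition gram :: "rat \<Rightarrow> rat \<Rightarrow> rat" where
  "gram x y = (\<Sum>n<p. s_at n x * s_at n y)"

text \<open>The dual recurrence at \<open>x\<close> is multiplied by
  \<open>(2 * x + 3) * s_at n (x + 1)\<close>, the one at \<open>x + 1\<close> by
  \<open>(2 * x + 1) * s_at n x\<close>. The terms with \<open>2 * n + 1\<close> then cancel, so the
  relation can be summed over \<open>n\<close>.\<close>

lemma gram_eliminate:
  "(x + 1)\<^sup>2 * ((2 * x + 3) * gram (x + 1) (x + 1) + (2 * x + 1) * gram x x)
    = (2 * x + 3) * (x\<^sup>2 * gram (x - 1) (x + 1)) + (2 * x + 1) * ((x + 2)\<^sup>2 * gram x (x + 2))"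
proof -
  have "(x + 1)\<^sup>2 * ((2 * x + 3) * (s_at n (x + 1) * s_at n (x + 1)) + (2 * x + 1) * (s_at n x * s_at n x))
    = (2 * x + 3) * (x\<^sup>2 * (s_at n (x - 1) * s_at n (x + 1))) + (2 * x + 1) * ((x + 2)\<^sup>2 * (s_at n x * s_at n (x + 2)))" for n
  proof -
    have 1: "(x + 1)\<^sup>2 * s_at n (x + 1) = (2 * x + 1) * (2 * of_nat n + 1) * s_at n x + x\<^sup>2 * s_at n (x - 1)"
      by (rule s_at_dual_recurrence)
    have 2: "(x + 2)\<^sup>2 * s_at n (x + 2) = (2 * x + 3) * (2 * of_nat n + 1) * s_at n (x + 1) + (x + 1)\<^sup>2 * s_at n x"
      using s_at_dual_recurrence [of "x + 1" n] by (simp add: add.assoc distrib_left)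
    have "(x + 1)\<^sup>2 * ((2 * x + 3) * (s_at n (x + 1) * s_at n (x + 1)) + (2 * x + 1) * (s_at n x * s_at n x))
      = (2 * x + 3) * s_at n (x + 1) * ((x + 1)\<^sup>2 * s_at n (x + 1)) + (2 * x + 1) * s_at n x * ((x + 1)\<^sup>2 * s_at n x)"
      by (simp add: algebra_simps)
    also have "(x + 1)\<^sup>2 * s_at n x = (x + 2)\<^sup>2 * s_at n (x + 2) - (2 * x + 3) * (2 * of_nat n + 1) * s_at n (x + 1)"
      using 2 by simp
    finally show ?thesis unfolding 1 by (simp add: algebra_simps)
  qed
  then show ?thesis
    unfolding gram_def sum_distrib_left sum.distrib [symmetric] by simp
qed

text \<open>Here \<open>l - m = 2 * (2 * x + 1)\<close>. Replacing the values at
  \<open>x + 1\<close> by the dual recurrence produces another factor \<open>2 * x + 1\<close>,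
  which cancels exactly; no precision is lost even where \<open>p\<close> divides it.\<close>

lemma gram_off_diagonal:
  assumes "2 * x + 1 \<noteq> 0"
  shows "2 * ((x + 1)\<^sup>2 * gram (x - 1) (x + 1))
    = P\<^sup>2 * ((2 * P + 1) * s_at p x * s_at (p - 1) (x - 1) - (2 * P - 1) * s_at (p - 1) x * s_at p (x - 1))"
proof -
  have m: "2 * of_nat (p - 1) + 1 = 2 * P - 1" using p_gt_3 by (simp add: of_nat_diff)
  have "gram (x - 1) (x + 1) = gram (x + 1) (x - 1)" by (simp add: gram_def mult.commute)
  then have cd: "2 * (2 * x + 1) * gram (x - 1) (x + 1)
      = P\<^sup>2 * (s_at p (x + 1) * s_at (p - 1) (x - 1) - s_at (p - 1) (x + 1) * s_at p (x - 1))"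
    using christoffel_darboux_p [of "(x + 1) * (x + 1 + 1)" "(x - 1) * (x - 1 + 1)"]
    unfolding gram_def s_at_def by (simp add: algebra_simps)
  have "(2 * x + 1) * (2 * ((x + 1)\<^sup>2 * gram (x - 1) (x + 1))) = (x + 1)\<^sup>2 * (2 * (2 * x + 1) * gram (x - 1) (x + 1))"
    by (simp add: mult_ac)
  also have "\<dots> = P\<^sup>2 * (((x + 1)\<^sup>2 * s_at p (x + 1)) * s_at (p - 1) (x - 1)
      - ((x + 1)\<^sup>2 * s_at (p - 1) (x + 1)) * s_at p (x - 1))"
    unfolding cd by (simp add: right_diff_distrib mult_ac)
  also have "\<dots> = (2 * x + 1) * (P\<^sup>2 * ((2 * P + 1) * s_at p x * s_at (p - 1) (x - 1) - (2 * P - 1) * s_at (p - 1) x * s_at p (x - 1)))"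
    unfolding s_at_dual_recurrence m by (simp add: algebra_simps)
  finally show ?thesis using assms by simp
qed

text \<open>The prefactor \<open>P\<^sup>2\<close> lifts the values of \<open>s_at p\<close> and
  \<open>s_at (p - 1)\<close> modulo \<open>p\<close> squared to precision 4. The constant terms of
  the bracket cancel, which yields the third \<open>P\<close>.\<close>

lemma pcong_gram_off_diagonal:
  assumes a: "0 < a" "a < p" and x: "x = of_nat a"
  shows "pcong 4 ((x + 1)\<^sup>2 * gram (x - 1) (x + 1)) ((- 1) ^ Suc a * 2 * P ^ 3 * (x + 1) / x)"
proof -
  obtain c where c: "a = Suc c" using a gr0_conv_Suc by blast
  let ?h = "harmonic c" and ?e = "(- 1 :: rat) ^ c" and ?y = "1 / x"
  have h: "?h \<in> Zp" using a c by (intro Zp_harmonic) simp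
  have y: "?y \<in> Zp" using a unfolding x by (intro Zp_divide_of_nat Zp_1)
  have x1: "x - 1 = of_nat c" and ha: "harmonic a = ?h + ?y" and nz: "2 * x + 1 \<noteq> 0" "x \<noteq> 0"
    using c a x by (simp_all add: harmonic_Suc add.commute)
  have 1: "pcong 2 (s_at p x) (1 + 2 * P * (?h + ?y))" "pcong 2 (s_at (p - 1) x) (- ?e * (1 - 2 * P * (?h + ?y)))"
    using pcong_s_at_p [OF a(2)] pcong_s_at_pred_p [OF a(2)] unfolding x [symmetric] ha by (simp_all add: c)
  have 2: "pcong 2 (s_at p (x - 1)) (1 + 2 * P * ?h)" "pcong 2 (s_at (p - 1) (x - 1)) (?e * (1 - 2 * P * ?h))"
    using pcong_s_at_p [of c] pcong_s_at_pred_p [of c] a c unfolding x1 by simp_all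
  have "pcong 2 ((2 * P + 1) * s_at p x * s_at (p - 1) (x - 1) - (2 * P - 1) * s_at (p - 1) x * s_at p (x - 1))
      ((2 * P + 1) * (1 + 2 * P * (?h + ?y)) * (?e * (1 - 2 * P * ?h)) - (2 * P - 1) * (- ?e * (1 - 2 * P * (?h + ?y))) * (1 + 2 * P * ?h))"
    (is "pcong 2 _ ?R")
    by (intro pcong_diff pcong_mult pcong_mult_left 1 2 Zp_closed h y)
  also have "pcong 2 ?R (2 * (?e * 2 * P * (1 + ?y)))"
  proof (rule pcongI)
    have "(2 * P + 1) * (1 + 2 * P * (h + y)) * (e * (1 - 2 * P * h)) - (2 * P - 1) * (- e * (1 - 2 * P * (h + y))) * (1 + 2 * P * h)
        - 2 * (e * 2 * P * (1 + y)) = P\<^sup>2 * (- 16 * e * P * h * (h + y))" for e h y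
      by (simp add: power2_eq_square algebra_simps)
    then show "?R - 2 * (?e * 2 * P * (1 + ?y)) = P\<^sup>2 * (- 16 * ?e * P * ?h * (?h + ?y))" .
    show "- 16 * ?e * P * ?h * (?h + ?y) \<in> Zp" by (intro Zp_closed h y)
  qed
  finally have "pcong (2 + 2) (2 * ((x + 1)\<^sup>2 * gram (x - 1) (x + 1))) (P ^ 2 * (2 * (?e * 2 * P * (1 + ?y))))"
    unfolding gram_off_diagonal [OF nz(1)] by (rule pcong_scale)
  moreover have "P ^ 2 * (2 * (?e * 2 * P * (1 + ?y))) = 2 * ((- 1) ^ Suc a * 2 * P ^ 3 * (x + 1) / x)"
    using nz by (simp add: c power2_eq_square power3_eq_cube field_simps)
  ultimately have "pcong 4 (2 * ((x + 1)\<^sup>2 * gram (x - 1) (x + 1))) (2 * ((- 1) ^ Suc a * 2 * P ^ 3 * (x + 1) / x))"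
    by simp
  then show ?thesis
    by (rule pcong_cancel) (use Zp_inverse_of_nat [of 2] p_gt_3 in auto)
qed

lemma pcong_gram_step:
  assumes a: "Suc a < p" and x: "x = of_nat a"
  shows "pcong 4 ((2 * x + 3) * gram (x + 1) (x + 1) + (2 * x + 1) * gram x x) ((- 1) ^ a * 4 * P ^ 3 * (1 / (x + 1))\<^sup>2)"
proof -
  define y where "y = 1 / (x + 1)"
  have x1: "x + 1 = of_nat (Suc a)" using x by simp
  have nz: "x + 1 \<noteq> 0" unfolding x1 by (simp del: of_nat_Suc)
  have y: "y \<in> Zp" unfolding y_def x1 using a by (intro Zp_divide_of_nat Zp_1) auto
  have yx: "y * (x + 1) = 1" "(x + 1) * y = 1" using nz by (simp_all add: y_def)
  have xZ: "x \<in> Zp" unfolding x by (rule Zp_of_nat)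
  \<comment> \<open>The weight \<open>(x + 1)\<^sup>2\<close> is changed to \<open>x\<^sup>2\<close>
    by the factor \<open>(x * y)\<^sup>2\<close>; for \<open>a = 0\<close> both sides
    vanish.\<close>
  have off1: "pcong 4 (x\<^sup>2 * gram (x - 1) (x + 1)) ((- 1) ^ Suc a * 2 * P ^ 3 * x * y)"
  proof (cases "a = 0")
    case True
    then show ?thesis using x by (simp add: pcong_refl)
  next
    case False
    then have "pcong 4 ((x * y)\<^sup>2 * ((x + 1)\<^sup>2 * gram (x - 1) (x + 1))) ((x * y)\<^sup>2 * ((- 1) ^ Suc a * 2 * P ^ 3 * (x + 1) / x))"
      using a x by (intro pcong_mult_left pcong_gram_off_diagonal Zp_closed xZ y) auto
    moreover have "(x * y)\<^sup>2 * ((x + 1)\<^sup>2 * gram (x - 1) (x + 1)) = x\<^sup>2 * gram (x - 1) (x + 1)"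
      using nz by (simp add: y_def power_divide power_mult_distrib)
    moreover have "(x * y)\<^sup>2 * ((- 1) ^ Suc a * 2 * P ^ 3 * (x + 1) / x) = (- 1) ^ Suc a * 2 * P ^ 3 * x * y"
      using nz False x by (simp add: y_def power2_eq_square)
    ultimately show ?thesis by simp
  qed
  have off2: "pcong 4 ((x + 2)\<^sup>2 * gram x (x + 2)) ((- 1) ^ a * 2 * P ^ 3 * (x + 2) * y)"
    using pcong_gram_off_diagonal [of "Suc a" "x + 1"] a x1 by (simp add: y_def add.assoc add.commute)
  have "pcong 4 ((x + 1)\<^sup>2 * ((2 * x + 3) * gram (x + 1) (x + 1) + (2 * x + 1) * gram x x))
     ((2 * x + 3) * ((- 1) ^ Suc a * 2 * P ^ 3 * x * y) + (2 * x + 1) * ((- 1) ^ a * 2 * P ^ 3 * (x + 2) * y))"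
    unfolding gram_eliminate by (intro pcong_add pcong_mult_left off1 off2 Zp_closed xZ)
  also have "(2 * x + 3) * ((- 1) ^ Suc a * 2 * P ^ 3 * x * y) + (2 * x + 1) * ((- 1) ^ a * 2 * P ^ 3 * (x + 2) * y)
      = (- 1) ^ a * 4 * P ^ 3 * ((x + 1) * y)"
    by (simp add: algebra_simps)
  finally have "pcong 4 (y\<^sup>2 * ((x + 1)\<^sup>2 * ((2 * x + 3) * gram (x + 1) (x + 1) + (2 * x + 1) * gram x x))) (y\<^sup>2 * ((- 1) ^ a * 4 * P ^ 3 * ((x + 1) * y)))"
    by (intro pcong_mult_left Zp_closed y)
  moreover have "y\<^sup>2 * (x + 1)\<^sup>2 = 1" unfolding power_mult_distrib [symmetric] yx by simp
  then have "y\<^sup>2 * ((x + 1)\<^sup>2 * z) = z" for z by (simp flip: mult.assoc)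
  moreover have "y\<^sup>2 * ((- 1) ^ a * 4 * P ^ 3 * ((x + 1) * y)) = (- 1) ^ a * 4 * P ^ 3 * y\<^sup>2"
    unfolding yx by simp
  ultimately show ?thesis unfolding y_def [symmetric] by simp
qed

text \<open>The induction starts at \<open>gram 0 0 = P\<close>, all summands being 1, and the
  alternating sign turns each step into a subtraction.\<close>

lemma pcong_gram_diagonal:
  assumes "a < p"
  shows "pcong 4 ((- 1) ^ a * (2 * of_nat a + 1) * gram (of_nat a) (of_nat a)) (P - 4 * P ^ 3 * harmonic2 a)"
  using assms
proof (induction a)
  case 0
  show ?case by (simp add: gram_def harmonic2_def pcong_refl s_at_0)
next
  case (Suc a)
  let ?x = "of_nat a :: rat" and ?e = "(- 1 :: rat) ^ a"
  have e: "?e * ?e = 1" by (simp flip: power_mult_distrib)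
  have "pcong 4 (?e * (2 * ?x + 1) * gram ?x ?x - ?e * ((2 * ?x + 3) * gram (?x + 1) (?x + 1) + (2 * ?x + 1) * gram ?x ?x))
      ((P - 4 * P ^ 3 * harmonic2 a) - ?e * (?e * 4 * P ^ 3 * (1 / (?x + 1))\<^sup>2))"
    using Suc by (intro pcong_diff pcong_mult_left pcong_gram_step Zp_closed) auto
  moreover have "?e * (2 * ?x + 1) * gram ?x ?x - ?e * ((2 * ?x + 3) * gram (?x + 1) (?x + 1) + (2 * ?x + 1) * gram ?x ?x)
      = (- 1) ^ Suc a * (2 * of_nat (Suc a) + 1) * gram (of_nat (Suc a)) (of_nat (Suc a))"
    by (simp add: algebra_simps)
  moreover have "(P - 4 * P ^ 3 * harmonic2 a) - ?e * (?e * 4 * P ^ 3 * (1 / (?x + 1))\<^sup>2) = P - 4 * P ^ 3 * harmonic2 (Suc a)"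
    unfolding mult.assoc [symmetric] e harmonic2_Suc by (simp add: algebra_simps)
  ultimately show ?case by metis
qed

text \<open>At \<open>a = b\<close> the factor \<open>2 * a + 1\<close> is \<open>P\<close>, so
  dividing by it costs one of the four powers; the correction vanishes by
  \<open>pcong_harmonic2_half\<close>.\<close>

lemma pcong_gram_half:
  assumes b: "p = 2 * b + 1"
  shows "pcong 3 (gram (of_nat b) (of_nat b)) ((- 1) ^ b)"
proof -
  have P: "2 * of_nat b + 1 = P" and blt: "b < p" using b by simp_all
  have "pcong (3 + 1) (P ^ 3 * harmonic2 b) (P ^ 3 * 0)"
    by (intro pcong_scale pcong_harmonic2_half b)
  then have "pcong 4 (4 * (P ^ 3 * harmonic2 b)) (4 * 0)"
    by (intro pcong_mult_left [of 4] Zp_numeral) simp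
  then have "pcong 4 (P - 4 * (P ^ 3 * harmonic2 b)) (P - 4 * 0)" by (intro pcong_diff pcong_refl)
  then have "pcong 4 (P - 4 * P ^ 3 * harmonic2 b) P" by (simp add: mult.assoc)
  moreover have "pcong 4 ((- 1) ^ b * P * gram (of_nat b) (of_nat b)) (P - 4 * P ^ 3 * harmonic2 b)"
    using pcong_gram_diagonal [OF blt] unfolding P .
  ultimately have "pcong 4 ((- 1) ^ b * P * gram (of_nat b) (of_nat b)) P"
    by (rule pcong_trans [rotated])
  then have "pcong (1 + 3) (P ^ 1 * ((- 1) ^ b * gram (of_nat b) (of_nat b))) (P ^ 1 * 1)"
    by (simp add: mult_ac)
  then have "pcong 3 ((- 1) ^ b * gram (of_nat b) (of_nat b)) 1" by (rule pcong_descale)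
  then have "pcong 3 ((- 1) ^ b * ((- 1) ^ b * gram (of_nat b) (of_nat b))) ((- 1) ^ b * 1)"
    by (intro pcong_mult_left Zp_closed)
  then show ?thesis by (simp flip: mult.assoc power_mult_distrib)
qed

section \<open>Constancy of the diagonal on the residue class of \<open>-1/2\<close>\<close>

text \<open>The number \<open>u i\<close> is \<open>b * (b + 1) - i * (i + 1)\<close>. Its two
  factors sum to \<open>p\<close>, so its inverse is congruent to
  \<open>- (1 / (b - i))\<^sup>2\<close>, and the indices on either side of \<open>b\<close> each
  contribute \<open>- harmonic2 b\<close>.\<close>

lemma pcong_sum_inverse_half:
  assumes b: "p = 2 * b + 1"
  defines "u \<equiv> \<lambda>i :: nat. (int b - int i) * (int b + int i + 1)"
  shows "\<And>i. i < p \<Longrightarrow> i \<noteq> b \<Longrightarrow> \<not> int p dvd u i"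
    and "pcong 1 (\<Sum>i\<in>{..<p} - {b}. 1 / of_int (u i)) 0"
proof -
  have small: "\<not> int p dvd k" if "k \<noteq> 0" "\<bar>k\<bar> < int p" for k
    using that dvd_imp_le_int [of k "int p"] by auto
  have f1: "\<not> int p dvd int b - int i" if "i < p" "i \<noteq> b" for i
    using that b by (intro small) auto
  have f2: "\<not> int p dvd int b + int i + 1" if "i < p" "i \<noteq> b" for i
  proof -
    \<comment> \<open>Subtracting \<open>p = 2 * b + 1\<close> leaves \<open>i - b\<close>, nonzero
      and smaller than \<open>p\<close> in absolute value.\<close>
    have "\<not> int p dvd int b + int i + 1 - int p" using that b by (intro small) auto
    then show ?thesis by (simp add: dvd_diff_left_iff)
  qed
  show nd: "\<not> int p dvd u i" if "i < p" "i \<noteq> b" for i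
    unfolding u_def using f1 [OF that] f2 [OF that] prime_int_p by (simp add: prime_dvd_mult_iff)
  let ?v = "\<lambda>i. of_int (int b - int i) :: rat"
  have "pcong 1 (1 / of_int (u i)) (- (1 / ?v i)\<^sup>2)" if i: "i < p" "i \<noteq> b" for i
  proof (rule pcongI)
    let ?w = "of_int (int b + int i + 1) :: rat"
    have "int b - int i \<noteq> 0" "int b + int i + 1 \<noteq> 0" using i by auto
    then have nz: "?v i \<noteq> 0" "?w \<noteq> 0" by (simp_all only: of_int_eq_0_iff not_False_eq_True)
    have "?v i + ?w = P" using b by simp
    have "1 / of_int (u i) - - (1 / ?v i)\<^sup>2 = (?v i + ?w) * (inverse (?v i) * inverse (?v i) * inverse ?w)"
      using nz unfolding u_def of_int_mult by (simp add: power2_eq_square field_simps del: of_int_diff of_int_add)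
    then show "1 / of_int (u i) - - (1 / ?v i)\<^sup>2 = P ^ 1 * (inverse (?v i) * inverse (?v i) * inverse ?w)"
      unfolding \<open>?v i + ?w = P\<close> by simp
    show "inverse (?v i) * inverse (?v i) * inverse ?w \<in> Zp"
      using f1 [OF i] f2 [OF i] by (intro Zp_mult Zp_inverse_of_int)
  qed
  then have "pcong 1 (\<Sum>i\<in>{..<p} - {b}. 1 / of_int (u i)) (\<Sum>i\<in>{..<p} - {b}. - (1 / ?v i)\<^sup>2)"
    by (intro pcong_sum) auto
  also have "(\<Sum>i\<in>{..<p} - {b}. - (1 / ?v i)\<^sup>2) = (\<Sum>i<b. - (1 / ?v i)\<^sup>2) + (\<Sum>i\<in>{b<..<p}. - (1 / ?v i)\<^sup>2)"
  proof -
    have "{..<p} - {b} = {..<b} \<union> {b<..<p}" using b by auto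
    moreover have "{..<b} \<inter> {b<..<p} = {}" by auto
    ultimately show ?thesis by (simp only: sum.union_disjoint finite_lessThan finite_greaterThanLessThan)
  qed
  also have "(\<Sum>i<b. - (1 / ?v i)\<^sup>2) = - harmonic2 b"
    unfolding harmonic2_def sum_negf [symmetric]
    by (rule sum.reindex_bij_witness [of _ "\<lambda>i. b - 1 - i" "\<lambda>i. b - 1 - i"]) (auto simp: of_nat_diff)
  also have "(\<Sum>i\<in>{b<..<p}. - (1 / ?v i)\<^sup>2) = - harmonic2 b"
    unfolding harmonic2_def sum_negf [symmetric]
  proof (rule sum.reindex_bij_witness [of _ "\<lambda>j. b + 1 + j" "\<lambda>i. i - b - 1"])
    fix i assume i: "i \<in> {b<..<p}"
    then have "of_nat (Suc (i - b - 1)) = - ?v i" by (auto simp: of_nat_diff)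
    then show "- (1 / of_nat (Suc (i - b - 1)))\<^sup>2 = - (1 / ?v i)\<^sup>2" by (simp only: power_one_over power2_minus)
  qed (use b in auto)
  also have "pcong 1 (- harmonic2 b + - harmonic2 b) (- 0 + - 0)"
    by (intro pcong_add pcong_minus pcong_harmonic2_half b)
  finally show "pcong 1 (\<Sum>i\<in>{..<p} - {b}. 1 / of_int (u i)) 0" by simp
qed

text \<open>The factor \<open>i = b\<close> equals \<open>P\<^sup>2 * T\<close> and cancels the
  \<open>p\<close> squared of the denominator. The remaining product is constant modulo
  \<open>p\<close> cubed, because its linear term is \<open>P\<^sup>2 * T\<close> times the sum of
  the inverses of \<open>u i\<close>, divisible by \<open>p\<close>.\<close>

lemma pcong_central_term_p_half:
  assumes b: "p = 2 * b + 1"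
  obtains \<rho> where "\<rho> \<in> Zp"
    "\<And>T. T \<in> Zp \<Longrightarrow> pcong 3 (central_term p (of_nat b * (of_nat b + 1) + P\<^sup>2 * T)) (T * \<rho>)"
proof -
  define u where "u = (\<lambda>i :: nat. (int b - int i) * (int b + int i + 1))"
  define I where "I = {..<p} - {b}"
  have u1: "\<not> int p dvd u i" if "i \<in> I" for i
    using pcong_sum_inverse_half(1) [OF b, of i] that unfolding u_def I_def by simp
  have u2: "pcong 1 (\<Sum>i\<in>I. 1 / of_int (u i)) 0"
    unfolding u_def I_def by (rule pcong_sum_inverse_half(2) [OF b])
  define \<rho> :: rat where "\<rho> = (\<Prod>i\<in>I. of_int (u i)) * (inverse (fact (p - 1)))\<^sup>2"
  have \<rho>: "\<rho> \<in> Zp"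
    unfolding \<rho>_def using p_gt_3 by (intro Zp_closed Zp_inverse_fact) auto
  have "pcong 3 (central_term p (of_nat b * (of_nat b + 1) + P\<^sup>2 * T)) (T * \<rho>)" if T: "T \<in> Zp" for T
  proof -
    let ?w = "\<lambda>i. T * (1 / of_int (u i))"
    have nz: "of_int (u i) \<noteq> (0 :: rat)" if "i \<in> I" for i
      using u1 [OF that] by auto
    have factor: "of_nat b * (of_nat b + 1) + P\<^sup>2 * T - of_nat i * (of_nat i + 1) = of_int (u i) + P\<^sup>2 * T" for i
      by (simp add: u_def algebra_simps)
    have "(\<Prod>i<p. of_nat b * (of_nat b + 1) + P\<^sup>2 * T - of_nat i * (of_nat i + 1))
        = P\<^sup>2 * T * (\<Prod>i\<in>I. of_int (u i) + P\<^sup>2 * T)"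
      unfolding factor I_def using b by (subst prod.remove [of _ b]) (auto simp: u_def)
    also have "(\<Prod>i\<in>I. of_int (u i) + P\<^sup>2 * T) = (\<Prod>i\<in>I. of_int (u i) * (1 + P\<^sup>2 * ?w i))"
      using nz by (intro prod.cong refl) (simp add: field_simps)
    also have "\<dots> = (\<Prod>i\<in>I. of_int (u i)) * (\<Prod>i\<in>I. 1 + P\<^sup>2 * ?w i)" by (rule prod.distrib)
    finally have eq: "central_term p (of_nat b * (of_nat b + 1) + P\<^sup>2 * T) = T * \<rho> * (\<Prod>i\<in>I. 1 + P\<^sup>2 * ?w i)"
      by (simp add: central_term_def fact_p \<rho>_def power_mult_distrib power_inverse divide_inverse)
    have "pcong (2 * 2) (\<Prod>i\<in>I. 1 + P\<^sup>2 * ?w i) (1 + P\<^sup>2 * (\<Sum>i\<in>I. ?w i))"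
    proof (rule pcong_prod_one_plus)
      show "finite I" by (simp add: I_def)
      fix i assume "i \<in> I"
      then have "\<not> int p dvd u i" by (rule u1)
      then show "?w i \<in> Zp" using Zp_mult [OF T Zp_inverse_of_int] by (simp add: inverse_eq_divide)
    qed
    then have "pcong 3 (\<Prod>i\<in>I. 1 + P\<^sup>2 * ?w i) (1 + P\<^sup>2 * (\<Sum>i\<in>I. ?w i))" by (rule pcong_weaken) simp
    also have "(\<Sum>i\<in>I. ?w i) = T * (\<Sum>i\<in>I. 1 / of_int (u i))" by (simp only: sum_distrib_left)
    also have "pcong 3 (1 + P\<^sup>2 * (T * (\<Sum>i\<in>I. 1 / of_int (u i)))) (1 + P\<^sup>2 * (T * 0))"
    proof (rule pcong_add [OF pcong_refl])
      have "pcong (2 + 1) (P\<^sup>2 * (T * (\<Sum>i\<in>I. 1 / of_int (u i)))) (P\<^sup>2 * (T * 0))"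
        by (intro pcong_scale pcong_mult_left T u2)
      then show "pcong 3 (P\<^sup>2 * (T * (\<Sum>i\<in>I. 1 / of_int (u i)))) (P\<^sup>2 * (T * 0))"
        by (simp only: numeral_3_eq_3 add_2_eq_Suc One_nat_def)
    qed
    finally have "pcong 3 (T * \<rho> * (\<Prod>i\<in>I. 1 + P\<^sup>2 * ?w i)) (T * \<rho> * (1 + P\<^sup>2 * (T * 0)))"
      using T \<rho> by (intro pcong_mult_left [of "T * \<rho>"] Zp_mult)
    then show ?thesis unfolding eq by simp
  qed
  with \<rho> show ?thesis by (rule that)
qed

lemma linear_mod_s_lambda:
  assumes "n < p" "l \<in> Zp"
  shows "linear_mod 2 (\<lambda>T. s_lambda n (l + P\<^sup>2 * T))"
proof (rule s_lambda_closure [OF linear_mod_const linear_mod_add linear_mod_mult])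
  show "linear_mod 2 (\<lambda>T. l + P\<^sup>2 * T)"
    unfolding linear_mod_def using assms
    by (intro bexI [of _ l] bexI [of _ 1]) (auto intro!: pcong_refl Zp_1)
qed (use assms in auto)

text \<open>The parameters \<open>T + 1\<close> and \<open>T - 1\<close> give
  \<open>l - m = 2 * P\<^sup>2\<close>, cancelling the whole prefactor in Christoffel--Darboux. Both
  entries of the determinant are linear in \<open>T\<close> modulo \<open>p\<close> cubed, and in
  the determinant \<open>T\<close> drops out.\<close>

lemma sum_s_lambda_squares_half_const:
  assumes b: "p = 2 * b + 1"
  obtains K where "\<And>T. T \<in> Zp \<Longrightarrow>
    pcong 3 (\<Sum>n<p. (s_lambda n (of_nat b * (of_nat b + 1) + P\<^sup>2 * T))\<^sup>2) K"
proof -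
  define L where "L = (of_nat b * (of_nat b + 1) :: rat)"
  have L: "L \<in> Zp" unfolding L_def by (intro Zp_closed)
  let ?s = "\<lambda>n T. s_lambda n (L + P\<^sup>2 * T)"
  define A where "A = s_lambda p L"
  obtain \<rho> where \<rho>: "\<rho> \<in> Zp" "\<And>T. T \<in> Zp \<Longrightarrow> pcong 3 (central_term p (L + P\<^sup>2 * T)) (T * \<rho>)"
    using pcong_central_term_p_half [OF b] unfolding L_def by blast
  have c0: "central_term p L = 0"
    unfolding central_term_def L_def using b by (auto intro!: prod_zero)
  have sp: "pcong 3 (?s p T) (A + T * \<rho>)" if T: "T \<in> Zp" for T
  proof -
    have "pcong 2 (L + P\<^sup>2 * T) L" using T by (intro pcongI [of _ _ _ T]) simp_all
    then have "pcong 3 (?s p T - central_term p (L + P\<^sup>2 * T)) (A - 0)"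
      using pcong_s_lambda_p [of 2 "L + P\<^sup>2 * T" L] L c0 by (simp add: A_def numeral_3_eq_3 numeral_2_eq_2)
    from pcong_add [OF this \<rho>(2) [OF T]] show ?thesis by simp
  qed
  have A: "A \<in> Zp"
  proof -
    have "A = (\<Sum>k<p. of_nat (p choose k) * central_term k L)"
      unfolding A_def s_lambda_p_split c0 by simp
    also have "\<dots> \<in> Zp" using L by (intro Zp_closed Zp_central_term) auto
    finally show ?thesis .
  qed
  obtain S S1 where S: "S \<in> Zp" "S1 \<in> Zp" "\<And>T. T \<in> Zp \<Longrightarrow> pcong (2 * 2) (?s (p - 1) T) (S + P\<^sup>2 * S1 * T)"
    using linear_mod_s_lambda [of "p - 1" L] L p_gt_3 unfolding linear_mod_def by auto
  have S3: "pcong 3 (?s (p - 1) T) (S + P\<^sup>2 * S1 * T)" if "T \<in> Zp" for T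
    using S(3) [OF that] by (rule pcong_weaken) simp
  let ?G = "\<lambda>T U. \<Sum>n<p. ?s n T * ?s n U"
  have "pcong 3 (\<Sum>n<p. (?s n T)\<^sup>2) (\<rho> * S - P\<^sup>2 * A * S1)" if T: "T \<in> Zp" for T
  proof -
    have T1: "T + 1 \<in> Zp" "T - 1 \<in> Zp" using T by (auto intro: Zp_closed)
    have "pcong 3 ((?s n T)\<^sup>2) (?s n (T + 1) * ?s n (T - 1))" if n: "n < p" for n
    proof -
      obtain \<alpha> \<beta> where ab: "\<alpha> \<in> Zp" "\<beta> \<in> Zp" "\<And>T. T \<in> Zp \<Longrightarrow> pcong (2 * 2) (?s n T) (\<alpha> + P\<^sup>2 * \<beta> * T)"
        using linear_mod_s_lambda [OF n L] unfolding linear_mod_def by auto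
      let ?q = "\<lambda>T. \<alpha> + P\<^sup>2 * \<beta> * T"
      have q: "?q T \<in> Zp" if "T \<in> Zp" for T using that ab by (auto intro!: Zp_closed)
      have ab3: "pcong 3 (?s n T) (?q T)" if "T \<in> Zp" for T
        using ab(3) [OF that] by (rule pcong_weaken) simp
      have "pcong 3 (?s n T * ?s n T) (?q T * ?q T)" by (intro pcong_mult ab3 q T)
      \<comment> \<open>The two products differ by \<open>P ^ 4 * \<beta>\<^sup>2\<close>, so the
        diagonal may be replaced by a spread pair.\<close>
      also have "pcong 3 (?q T * ?q T) (?q (T + 1) * ?q (T - 1))"
        by (rule pcongI [of _ _ _ "P * \<beta>\<^sup>2"])
           (simp add: power2_eq_square power3_eq_cube algebra_simps, intro Zp_closed ab)
      also have "pcong 3 (?q (T + 1) * ?q (T - 1)) (?s n (T + 1) * ?s n (T - 1))"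
        by (rule pcong_sym) (intro pcong_mult ab3 q T1)
      finally show ?thesis by (simp add: power2_eq_square)
    qed
    then have "pcong 3 (\<Sum>n<p. (?s n T)\<^sup>2) (?G (T + 1) (T - 1))" by (intro pcong_sum) auto
    also have "pcong 3 (?G (T + 1) (T - 1)) (\<rho> * S - P\<^sup>2 * A * S1)"
    proof -
      let ?B = "?s p (T + 1) * ?s (p - 1) (T - 1) - ?s (p - 1) (T + 1) * ?s p (T - 1)"
      have "(L + P\<^sup>2 * (T + 1)) - (L + P\<^sup>2 * (T - 1)) = P\<^sup>2 * 2" by (simp add: algebra_simps)
      then have "P\<^sup>2 * (2 * ?G (T + 1) (T - 1)) = P\<^sup>2 * ?B"
        using christoffel_darboux_p [of "L + P\<^sup>2 * (T + 1)" "L + P\<^sup>2 * (T - 1)"] by (simp only: mult.assoc)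
      then have GB: "2 * ?G (T + 1) (T - 1) = ?B" by simp
      let ?a = "\<lambda>T. A + T * \<rho>" and ?c = "\<lambda>T. S + P\<^sup>2 * S1 * T"
      have "pcong 3 ?B (?a (T + 1) * ?c (T - 1) - ?c (T + 1) * ?a (T - 1))"
        by (intro pcong_diff pcong_mult sp S3 T1 Zp_closed T A S \<rho>)
      also have "?a (T + 1) * ?c (T - 1) - ?c (T + 1) * ?a (T - 1) = 2 * (\<rho> * S - P\<^sup>2 * A * S1)"
        by (simp add: algebra_simps)
      finally have "pcong 3 (2 * ?G (T + 1) (T - 1)) (2 * (\<rho> * S - P\<^sup>2 * A * S1))" unfolding GB .
      then show ?thesis
        by (rule pcong_cancel) (use Zp_inverse_of_nat [of 2] p_gt_3 in auto)
    qed
    finally show ?thesis .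
  qed
  then show ?thesis using that unfolding L_def by blast
qed

text \<open>Since \<open>2 * b + 1 = p\<close>, the value \<open>x * (x + 1)\<close> differs from
  \<open>b * (b + 1)\<close> by \<open>P\<^sup>2 * t * (t + 1)\<close>. The constant is read off at
  \<open>T = 0\<close>.\<close>

theorem pcong_sum_s_at_squares_half:
  assumes b: "p = 2 * b + 1" and x: "x = of_nat b + P * of_int t"
  shows "pcong 3 (\<Sum>n<p. (s_at n x)\<^sup>2) ((- 1) ^ b)"
proof -
  obtain K where K: "\<And>T. T \<in> Zp \<Longrightarrow>
      pcong 3 (\<Sum>n<p. (s_lambda n (of_nat b * (of_nat b + 1) + P\<^sup>2 * T))\<^sup>2) K"
    using sum_s_lambda_squares_half_const [OF b] by blast
  have P: "P = 2 * of_nat b + 1" using b by simp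
  have "x * (x + 1) = of_nat b * (of_nat b + 1) + P * of_int t * (2 * of_nat b + 1) + P\<^sup>2 * of_int t * of_int t"
    unfolding x by (simp add: power2_eq_square algebra_simps)
  then have "x * (x + 1) = of_nat b * (of_nat b + 1) + P\<^sup>2 * (of_int t * (of_int t + 1))"
    unfolding P [symmetric] by (simp add: power2_eq_square algebra_simps)
  then have "pcong 3 (\<Sum>n<p. (s_at n x)\<^sup>2) K"
    using K [of "of_int t * (of_int t + 1)"] by (simp add: s_at_def Zp_closed)
  moreover have "pcong 3 (gram (of_nat b) (of_nat b)) K"
    using K [OF Zp_0] by (simp add: s_at_def gram_def power2_eq_square)
  ultimately show ?thesis
    using pcong_trans [OF _ pcong_trans [OF pcong_sym pcong_gram_half [OF b]]] by blast
qed

section \<open>Transfer to the inverse limit\<close>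

lemma zpD:
  assumes "f \<in> zp p"
  shows "0 \<le> f n" "f n < int p ^ n" "f (Suc n) mod int p ^ n = f n"
proof -
  have *: "0 \<le> f n \<and> f n < int p ^ n \<and> f n = f (Suc n) mod int p ^ n"
    using assms unfolding zp_def by blast
  then show "0 \<le> f n" "f n < int p ^ n" by blast+
  from * show "f (Suc n) mod int p ^ n = f n" by (elim conjE) (rule sym)
qed

lemma zp_comp:
  assumes "f \<in> zp p" "m \<le> n"
  shows "f n mod int p ^ m = f m"
  using assms(2)
proof (induction n rule: dec_induct)
  case base
  then show ?case using zpD [OF assms(1)] by simp
next
  case (step n)
  have "f (Suc n) mod int p ^ m = f (Suc n) mod int p ^ n mod int p ^ m"
    using step.hyps by (simp add: mod_mod_cancel le_imp_power_dvd)
  also have "f (Suc n) mod int p ^ n = f n" by (rule zpD [OF assms(1)])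
  finally show ?case using step.IH by simp
qed

text \<open>Coherence needs checking only before reduction, where ring identities apply.\<close>

lemma zp_modI:
  assumes "\<And>n. int p ^ n dvd F (Suc n) - F n"
  shows "(\<lambda>n. F n mod int p ^ n) \<in> zp p"
proof -
  have "F n mod int p ^ n = F (Suc n) mod int p ^ Suc n mod int p ^ n" for n
    using assms [of n] by (simp add: mod_mod_cancel le_imp_power_dvd mod_eq_dvd_iff dvd_diff_commute)
  moreover have "0 < int p ^ n" for n using p_gt_3 by simp
  ultimately show ?thesis
    unfolding zp_def by (intro CollectI allI conjI pos_mod_sign pos_mod_bound)
qed

lemma zp_dvd_diff:
  assumes "f \<in> zp p"
  shows "int p ^ n dvd f (Suc n) - f n"
proof -
  have "f (Suc n) mod int p ^ n = f n mod int p ^ n"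
    using zp_comp [OF assms, of n "Suc n"] zp_comp [OF assms, of n n] by simp
  then show ?thesis by (simp add: mod_eq_dvd_iff)
qed

lemma zp_of_int_in: "zp_of_int p c \<in> zp p"
  unfolding zp_of_int_def by (rule zp_modI) simp

lemma zp_add_in: "f \<in> zp p \<Longrightarrow> g \<in> zp p \<Longrightarrow> zp_add p f g \<in> zp p"
  unfolding zp_add_def by (rule zp_modI) (use zp_dvd_diff in \<open>simp add: add_diff_add\<close>)

lemma zp_neg_in: "f \<in> zp p \<Longrightarrow> zp_neg p f \<in> zp p"
  unfolding zp_neg_def by (rule zp_modI) (use zp_dvd_diff dvd_diff_commute in fastforce)

lemma zp_diff_in: "f \<in> zp p \<Longrightarrow> g \<in> zp p \<Longrightarrow> zp_diff p f g \<in> zp p"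
  unfolding zp_diff_def by (intro zp_add_in zp_neg_in)

lemma zp_mul_in:
  assumes "f \<in> zp p" "g \<in> zp p"
  shows "zp_mul p f g \<in> zp p"
  unfolding zp_mul_def
proof (rule zp_modI)
  fix n
  have "f (Suc n) * g (Suc n) - f n * g n = (f (Suc n) - f n) * g (Suc n) + f n * (g (Suc n) - g n)"
    by (simp add: algebra_simps)
  then show "int p ^ n dvd f (Suc n) * g (Suc n) - f n * g n"
    using zp_dvd_diff assms by simp
qed

lemma zp_sum_in: "(\<And>a. a \<in> A \<Longrightarrow> F a \<in> zp p) \<Longrightarrow> zp_sum p F A \<in> zp p"
  unfolding zp_sum_def by (rule zp_modI) (auto simp flip: sum_subtractf intro!: dvd_sum zp_dvd_diff)

lemma zp_prod_in:
  assumes "\<And>a. a \<in> A \<Longrightarrow> F a \<in> zp p"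
  shows "zp_prod p F A \<in> zp p"
proof -
  have "(\<Prod>a\<in>A. F a (Suc n)) mod int p ^ n = (\<Prod>a\<in>A. F a n) mod int p ^ n" for n
    using zp_comp assms
    by (subst mod_prod_eq [symmetric], subst (2) mod_prod_eq [symmetric]) (auto intro!: arg_cong [of _ _ "\<lambda>x. x mod _"] prod.cong)
  then show ?thesis unfolding zp_prod_def by (intro zp_modI) (simp add: mod_eq_dvd_iff)
qed

lemmas zp_closed = zp_of_int_in zp_add_in zp_neg_in zp_diff_in zp_mul_in zp_sum_in zp_prod_in

text \<open>A nonzero first residue makes every \<open>u n\<close> invertible modulo
  \<open>p ^ n\<close>, with a Bezout coefficient as inverse. Cancelling \<open>u n\<close> yields
  both coherence of the quotients and uniqueness.\<close>

lemma zp_divide: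
  assumes u: "u \<in> zp p" and v: "v \<in> zp p" and nd: "\<not> int p dvd u 1"
  shows "\<exists>!q. q \<in> zp p \<and> zp_mul p u q = v"
proof -
  have cop: "coprime (u n) (int p ^ n)" for n
  proof (cases "n = 0")
    case False
    then have "u n mod int p = u 1" using zp_comp [OF u, of 1 n] by simp
    then have "\<not> int p dvd u n" using nd dvd_mod_iff [of "int p" "int p" "u n"] by simp
    then have "coprime (u n) (int p)"
      using prime_imp_coprime [OF prime_int_p] coprime_commute by blast
    then show ?thesis using coprime_power_right_iff by blast
  qed simp
  define q where "q = (\<lambda>n. (v n * fst (bezout_coefficients (u n) (int p ^ n))) mod int p ^ n)"
  have uq: "(u n * q n) mod int p ^ n = v n" for n
  proof -
    let ?w = "fst (bezout_coefficients (u n) (int p ^ n))" and ?z = "snd (bezout_coefficients (u n) (int p ^ n))"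
    have "?w * u n + ?z * int p ^ n = 1"
      using bezout_coefficients_fst_snd [of "u n" "int p ^ n"] cop by simp
    moreover have "u n * (v n * ?w) = v n * (?w * u n + ?z * int p ^ n) + int p ^ n * (- ?z * v n)"
      by (simp add: algebra_simps)
    ultimately have "u n * (v n * ?w) = v n + int p ^ n * (- ?z * v n)" by (simp only: mult_1_right)
    then have "(u n * (v n * ?w)) mod int p ^ n = v n mod int p ^ n" by (simp only: mod_mult_self2)
    also have "\<dots> = v n" using zp_comp [OF v, of n n] by simp
    finally show ?thesis unfolding q_def by (simp add: mod_mult_right_eq)
  qed
  have cancel: "int p ^ n dvd r - s" if "(u n * r) mod int p ^ n = (u n * s) mod int p ^ n" for n r s
  proof -
    have "int p ^ n dvd u n * (r - s)" using that by (simp add: mod_eq_dvd_iff right_diff_distrib)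
    then show ?thesis using cop [of n] by (metis coprime_commute coprime_dvd_mult_right_iff)
  qed
  show ?thesis
  proof (rule ex1I [of _ q], rule conjI)
    have "int p ^ n dvd q (Suc n) - q n" for n
    proof (rule cancel)
      have "(u n * q (Suc n)) mod int p ^ n = (u (Suc n) * q (Suc n)) mod int p ^ n"
        using zp_comp [OF u, of n "Suc n"] by (metis mod_mult_left_eq le_SucI order.refl)
      also have "\<dots> = (u (Suc n) * q (Suc n)) mod int p ^ Suc n mod int p ^ n"
        by (simp add: mod_mod_cancel le_imp_power_dvd)
      also have "\<dots> = v n" unfolding uq using zp_comp [OF v, of n "Suc n"] by simp
      finally show "(u n * q (Suc n)) mod int p ^ n = (u n * q n) mod int p ^ n" unfolding uq .
    qed
    then have "(\<lambda>n. q n mod int p ^ n) \<in> zp p" by (rule zp_modI)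
    moreover have "(\<lambda>n. q n mod int p ^ n) = q" by (simp add: q_def)
    ultimately show "q \<in> zp p" by simp
    show "zp_mul p u q = v" unfolding zp_mul_def by (simp add: uq)
  next
    fix r assume r: "r \<in> zp p \<and> zp_mul p u r = v"
    have q': "q n mod int p ^ n = q n" for n by (simp add: q_def)
    show "r = q"
    proof
      fix n
      have "(u n * r n) mod int p ^ n = (u n * q n) mod int p ^ n"
        unfolding uq using r by (auto simp: zp_mul_def)
      then have "r n mod int p ^ n = q n mod int p ^ n" using cancel by (simp add: mod_eq_dvd_iff)
      then show "r n = q n" using zp_comp [of r n n] r q' by simp
    qed
  qed
qed

text \<open>Congruence modulo \<open>p ^ k\<close> is thereby read off from a single
  component.\<close>

lemma zp_cong_iff:
  assumes a: "a \<in> zp p" and b: "b \<in> zp p"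
  shows "zp_cong p k a b \<longleftrightarrow> a k = b k"
proof
  assume "zp_cong p k a b"
  then obtain c where "zp_diff p a b k = zp_mul p (zp_of_int p (int p ^ k)) c k"
    unfolding zp_cong_def by metis
  then have "(a k - b k) mod int p ^ k = 0"
    by (simp add: zp_diff_def zp_add_def zp_neg_def zp_mul_def zp_of_int_def mod_simps)
  then have "a k mod int p ^ k = b k mod int p ^ k" by (simp add: mod_eq_dvd_iff dvd_eq_mod_eq_0)
  then show "a k = b k" using zp_comp [OF a, of k k] zp_comp [OF b, of k k] by simp
next
  assume eq: "a k = b k"
  \<comment> \<open>Division by \<open>p ^ k\<close> costs \<open>k\<close> levels, so level
    \<open>n\<close> of the quotient is computed from level \<open>n + k\<close>.\<close>
  define d where "d = (\<lambda>n. (a (n + k) - b (n + k)) div int p ^ k)"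
  have d: "int p ^ k * d n = a (n + k) - b (n + k)" for n
  proof -
    have "a (n + k) mod int p ^ k = b (n + k) mod int p ^ k"
      using zp_comp [OF a, of k "n + k"] zp_comp [OF b, of k "n + k"] eq by simp
    then show ?thesis unfolding d_def by (simp add: mod_eq_dvd_iff)
  qed
  have "int p ^ n dvd d (Suc n) - d n" for n
  proof -
    have "int p ^ k * (d (Suc n) - d n) = (a (Suc (n + k)) - a (n + k)) - (b (Suc (n + k)) - b (n + k))"
      unfolding right_diff_distrib d by simp
    also have "int p ^ (n + k) dvd \<dots>" by (intro dvd_diff [OF zp_dvd_diff zp_dvd_diff] a b)
    finally show ?thesis by (simp add: power_add mult.commute)
  qed
  then have "(\<lambda>n. d n mod int p ^ n) \<in> zp p" by (rule zp_modI)
  moreover have "zp_diff p a b = zp_mul p (zp_of_int p (int p ^ k)) (\<lambda>n. d n mod int p ^ n)"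
  proof
    fix n
    have "a n = a (n + k) mod int p ^ n" "b n = b (n + k) mod int p ^ n"
      using zp_comp [OF a, of n "n + k"] zp_comp [OF b, of n "n + k"] by simp_all
    then show "zp_diff p a b n = zp_mul p (zp_of_int p (int p ^ k)) (\<lambda>n. d n mod int p ^ n) n"
      by (simp add: zp_diff_def zp_add_def zp_neg_def zp_mul_def zp_of_int_def mod_simps d)
  qed
  ultimately show "zp_cong p k a b" unfolding zp_cong_def by blast
qed

lemma zp_residue_eq:
  assumes "x \<in> zp p"
  shows "zp_residue p x = x 1"
  unfolding zp_residue_def
proof (rule the_equality)
  have "0 \<le> x 1 \<and> x 1 < int p" using zpD [OF assms, of 1] by simp
  then show "0 \<le> x 1 \<and> x 1 < int p \<and> zp_cong p 1 x (zp_of_int p (x 1))"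
    unfolding zp_cong_iff [OF assms zp_of_int_in] by (simp add: zp_of_int_def)
next
  fix m assume "0 \<le> m \<and> m < int p \<and> zp_cong p 1 x (zp_of_int p m)"
  then show "m = x 1"
    unfolding zp_cong_iff [OF assms zp_of_int_in] by (simp add: zp_of_int_def)
qed

text \<open>For \<open>k < p\<close> the factorial is a unit, so the definite description in
  \<open>zp_binom\<close> has a unique solution.\<close>

lemma zp_binom:
  assumes "k < p" "y \<in> zp p"
  shows "zp_binom p y k \<in> zp p"
    and "zp_mul p (zp_of_int p (fact k)) (zp_binom p y k)
      = zp_prod p (\<lambda>i. zp_diff p y (zp_of_int p (int i))) {..<k}"
proof -
  have "\<not> p dvd fact k" using assms prime_p by (simp add: prime_dvd_fact_iff)
  then have "\<not> int p dvd fact k" by (metis int_dvd_int_iff of_nat_fact)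
  then have "\<not> int p dvd zp_of_int p (fact k) 1" by (simp add: zp_of_int_def dvd_mod_iff)
  then have "\<exists>!z. z \<in> zp p \<and> zp_mul p (zp_of_int p (fact k)) z
      = zp_prod p (\<lambda>i. zp_diff p y (zp_of_int p (int i))) {..<k}"
    using assms by (intro zp_divide zp_closed)
  from theI' [OF this] show "zp_binom p y k \<in> zp p"
    "zp_mul p (zp_of_int p (fact k)) (zp_binom p y k)
      = zp_prod p (\<lambda>i. zp_diff p y (zp_of_int p (int i))) {..<k}"
    unfolding zp_binom_def by blast+
qed

lemma zp_s_in: "n < p \<Longrightarrow> x \<in> zp p \<Longrightarrow> zp_s p x n \<in> zp p"
  unfolding zp_s_def by (intro zp_closed zp_binom) auto

lemma pcong_mod: "pcong m (of_int (z mod int p ^ m)) (of_int z)"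
  unfolding pcong_of_int_iff by (simp add: mod_eq_dvd_iff [symmetric])

lemma pcong_zp_of_int: "pcong m (of_int (zp_of_int p c m)) (of_int c)"
  unfolding zp_of_int_def by (rule pcong_mod)

lemma pcong_zp_add: "pcong m (of_int (zp_add p f g m)) (of_int (f m) + of_int (g m))"
  unfolding zp_add_def of_int_add [symmetric] by (rule pcong_mod)

lemma pcong_zp_diff: "pcong m (of_int (zp_diff p f g m)) (of_int (f m) - of_int (g m))"
proof -
  have "zp_diff p f g m = (f m - g m) mod int p ^ m"
    by (simp add: zp_diff_def zp_add_def zp_neg_def mod_simps)
  then show ?thesis using pcong_mod [of m "f m - g m"] by simp
qed

lemma pcong_zp_mul: "pcong m (of_int (zp_mul p f g m)) (of_int (f m) * of_int (g m))"
  unfolding zp_mul_def of_int_mult [symmetric] by (rule pcong_mod)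

lemma pcong_zp_sum: "pcong m (of_int (zp_sum p F A m)) (\<Sum>a\<in>A. of_int (F a m))"
  unfolding zp_sum_def of_int_sum [symmetric] by (rule pcong_mod)

lemma pcong_zp_prod: "pcong m (of_int (zp_prod p F A m)) (\<Prod>a\<in>A. of_int (F a m))"
  unfolding zp_prod_def of_int_prod [symmetric] by (rule pcong_mod)

text \<open>Both sides become the same falling product after multiplication by the unit
  \<open>fact k\<close>.\<close>

lemma pcong_zp_binom:
  assumes k: "k < p" and y: "y \<in> zp p" "pcong m (of_int (y m)) Y" "Y \<in> Zp"
  shows "pcong m (of_int (zp_binom p y k m)) (Y gchoose k)"
proof -
  let ?z = "zp_binom p y k"
  have "pcong m (of_int (zp_prod p (\<lambda>i. zp_diff p y (zp_of_int p (int i))) {..<k} m)) (\<Prod>i<k. Y - of_nat i)"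
  proof (rule pcong_trans [OF pcong_zp_prod], rule pcong_prod)
    fix i
    have "pcong m (of_int (y m) - of_int (zp_of_int p (int i) m)) (Y - of_nat i)"
      using pcong_zp_of_int [of m "int i"] y by (intro pcong_diff) auto
    then show "pcong m (of_int (zp_diff p y (zp_of_int p (int i)) m)) (Y - of_nat i)"
      by (rule pcong_trans [OF pcong_zp_diff])
  qed (intro Zp_closed y)
  then have "pcong m (of_int (zp_mul p (zp_of_int p (fact k)) ?z m)) (\<Prod>i<k. Y - of_nat i)"
    unfolding zp_binom [OF k y(1)] .
  moreover have "pcong m (of_int (zp_mul p (zp_of_int p (fact k)) ?z m)) (fact k * of_int (?z m))"
  proof (rule pcong_trans [OF pcong_zp_mul], rule pcong_mult [OF _ pcong_refl])
    show "pcong m (of_int (zp_of_int p (fact k) m)) (fact k)"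
      using pcong_zp_of_int [of m "fact k"] by simp
    show "fact k \<in> Zp" using Zp_of_int [of "fact k"] by simp
  qed (rule Zp_of_int)
  ultimately have "pcong m (fact k * of_int (?z m)) (\<Prod>i<k. Y - of_nat i)"
    using pcong_trans pcong_sym by blast
  moreover have "(\<Prod>i<k. Y - of_nat i) = fact k * (Y gchoose k)"
    by (simp add: gbinomial_prod_rev atLeast0LessThan)
  ultimately show ?thesis
    using pcong_cancel [OF _ Zp_inverse_fact [OF k]] by simp
qed

text \<open>Component \<open>m\<close> depends on \<open>x\<close> only through the integer
  \<open>x m\<close>, so the rational results apply to that representative.\<close>

lemma pcong_zp_s:
  assumes n: "n < p" and x: "x \<in> zp p"
  shows "pcong m (of_int (zp_s p x n m)) (s_at n (of_int (x m)))"
proof -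
  let ?X = "of_int (x m) :: rat"
  have "pcong m (of_int (zp_mul p (zp_of_int p (int (n choose k))) (zp_mul p (zp_binom p x k) (zp_binom p (zp_add p x (zp_of_int p (int k))) k)) m))
      (of_nat (n choose k) * central_term k (?X * (?X + 1)))" if "k \<le> n" for k
  proof -
    have k: "k < p" using that n by simp
    have y: "pcong m (of_int (zp_add p x (zp_of_int p (int k)) m)) (?X + of_nat k)"
      using pcong_zp_of_int [of m "int k"] by (intro pcong_trans [OF pcong_zp_add] pcong_add pcong_refl) simp
    have G: "y gchoose k \<in> Zp" if "y \<in> Zp" for y
      unfolding gbinomial_prod_rev divide_inverse using that by (intro Zp_closed Zp_inverse_fact k)
    have XZ: "?X \<in> Zp" by (rule Zp_of_int)
    have "pcong m (of_int (zp_mul p (zp_binom p x k) (zp_binom p (zp_add p x (zp_of_int p (int k))) k) m))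
        ((?X gchoose k) * ((?X + of_nat k) gchoose k))"
      by (rule pcong_trans [OF pcong_zp_mul])
         (intro pcong_mult pcong_zp_binom k x y pcong_refl zp_closed G XZ Zp_closed)
    moreover have "pcong m (of_int (zp_of_int p (int (n choose k)) m)) (of_nat (n choose k))"
      using pcong_zp_of_int [of m "int (n choose k)"] by simp
    ultimately show ?thesis
      unfolding central_term_gbinomial
      by (intro pcong_trans [OF pcong_zp_mul [of m "zp_of_int p _"]] pcong_mult [of m "of_int (zp_of_int p _ m)"]
          G XZ Zp_closed)
  qed
  then show ?thesis
    unfolding zp_s_def s_at_def s_lambda_def
    by (intro pcong_trans [OF pcong_zp_sum]) (auto simp: atLeast0AtMost intro!: pcong_sum)
qed

end

text \<open>The fraction is encoded as a \<open>p\<close>-adic integer \<open>q\<close> solving the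
  equation with denominator \<open>2x + 1\<close> cleared. The proof splits on whether
  \<open>p\<close> divides this denominator.\<close>

theorem theorem1p2:
  fixes p :: nat and x :: "nat \<Rightarrow> int"
  assumes "prime p" and "p > 3" and "x \<in> zp p"
    and "zp_add p (zp_mul p (zp_of_int p 2) x) (zp_of_int p 1) \<noteq> zp_of_int p 0"
  shows "\<exists>q\<in>zp p.
     zp_mul p (zp_add p (zp_mul p (zp_of_int p 2) x) (zp_of_int p 1)) q
       = zp_add p (zp_of_int p (int p))
           (zp_mul p (zp_of_int p 2) (zp_diff p x (zp_of_int p (zp_residue p x))))
     \<and> zp_cong p 3 (zp_sum p (\<lambda>n. zp_mul p (zp_s p x n) (zp_s p x n)) {0..p-1})
                   (zp_mul p (zp_of_int p ((-1) ^ nat (zp_residue p x))) q)"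
proof -
  interpret prime_gt_3 p by unfold_locales (rule assms)+
  define a where "a = nat (x 1)"
  \<comment> \<open>Level 3 suffices for a congruence modulo \<open>p\<close> cubed; its last digit
    is \<open>a\<close>, and \<open>t\<close> holds the other digits.\<close>
  define t where "t = x 3 div int p"
  define X where "X = (of_int (x 3) :: rat)"
  define S where "S = zp_sum p (\<lambda>n. zp_mul p (zp_s p x n) (zp_s p x n)) {0..p-1}"
  define u where "u = zp_add p (zp_mul p (zp_of_int p 2) x) (zp_of_int p 1)"
  define v where "v = zp_add p (zp_of_int p (int p)) (zp_mul p (zp_of_int p 2) (zp_diff p x (zp_of_int p (zp_residue p x))))"
  have x: "x \<in> zp p" by (rule assms)
  have x1: "x 1 = x 3 mod int p" using zp_comp [OF x, of 1 3] by simp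
  then have ia: "int a = x 3 mod int p" and a: "a < p"
    using p_gt_3 by (simp_all add: a_def nat_less_iff)
  have res: "zp_residue p x = int a" using zp_residue_eq [OF x] ia x1 by simp
  have x3: "x 3 = int a + int p * t" unfolding ia t_def by simp
  then have X: "X = of_nat a + P * of_int t" by (simp add: X_def)
  have XZ: "X \<in> Zp" unfolding X_def by (rule Zp_of_int)
  have Sin: "S \<in> zp p" unfolding S_def using p_gt_3 by (intro zp_closed zp_s_in x) auto
  have uin: "u \<in> zp p" unfolding u_def by (intro zp_closed x)
  have vin: "v \<in> zp p" unfolding v_def by (intro zp_closed x)
  have range: "{0..p - 1} = {..<p}" using p_gt_3 by auto
  have S3: "pcong 3 (of_int (S 3)) (\<Sum>n<p. (s_at n X)\<^sup>2)"
    unfolding S_def range power2_eq_square X_def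
    by (intro pcong_trans [OF pcong_zp_sum] pcong_sum pcong_trans [OF pcong_zp_mul] pcong_mult
        pcong_zp_s x Zp_s_at Zp_of_int) auto
  have u3: "pcong 3 (of_int (u 3)) (2 * X + 1)"
  proof -
    have "pcong 3 (of_int (zp_mul p (zp_of_int p 2) x 3)) (2 * X)"
      using pcong_zp_of_int [of 3 2] unfolding X_def
      by (intro pcong_trans [OF pcong_zp_mul] pcong_mult pcong_refl Zp_closed) auto
    moreover have "pcong 3 (of_int (zp_of_int p 1 3)) 1" using pcong_zp_of_int [of 3 1] by simp
    ultimately show ?thesis unfolding u_def by (intro pcong_trans [OF pcong_zp_add] pcong_add)
  qed
  have v3: "pcong 3 (of_int (v 3)) (P * (2 * of_int t + 1))"
  proof -
    have "pcong 3 (of_int (zp_diff p x (zp_of_int p (int a)) 3)) (X - of_nat a)"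
      using pcong_zp_of_int [of 3 "int a"] unfolding X_def
      by (intro pcong_trans [OF pcong_zp_diff] pcong_diff pcong_refl) auto
    then have "pcong 3 (of_int (zp_mul p (zp_of_int p 2) (zp_diff p x (zp_of_int p (int a))) 3)) (2 * (X - of_nat a))"
      using pcong_zp_of_int [of 3 2] XZ
      by (intro pcong_trans [OF pcong_zp_mul] pcong_mult Zp_closed) auto
    moreover have "pcong 3 (of_int (zp_of_int p (int p) 3)) P" using pcong_zp_of_int [of 3 "int p"] by simp
    ultimately have "pcong 3 (of_int (v 3)) (P + 2 * (X - of_nat a))"
      unfolding v_def res by (intro pcong_trans [OF pcong_zp_add] pcong_add)
    then show ?thesis unfolding X by (simp add: algebra_simps)
  qed
  have e3: "pcong 3 (of_int (zp_mul p (zp_of_int p ((- 1) ^ a)) q 3)) ((- 1) ^ a * of_int (q 3))" for q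
    using pcong_zp_of_int [of 3 "(- 1) ^ a"]
    by (intro pcong_trans [OF pcong_zp_mul] pcong_mult pcong_refl Zp_closed) auto
  \<comment> \<open>It remains to find \<open>q\<close> and to compare third components as rational
    numbers.\<close>
  have conclude: ?thesis
    if q: "q \<in> zp p" "zp_mul p u q = v" "pcong 3 (of_int (S 3)) ((- 1) ^ a * of_int (q 3))" for q
  proof -
    let ?R = "zp_mul p (zp_of_int p ((- 1) ^ a)) q"
    have Rin: "?R \<in> zp p" by (intro zp_closed q)
    have "pcong 3 (of_int (S 3)) (of_int (?R 3))" using pcong_trans [OF q(3) pcong_sym [OF e3 [of q]]] .
    then have "S 3 mod int p ^ 3 = ?R 3 mod int p ^ 3" unfolding pcong_of_int_iff by (simp add: mod_eq_dvd_iff)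
    then have "S 3 = ?R 3" using zp_comp [OF Sin, of 3 3] zp_comp [OF Rin, of 3 3] by simp
    then have "zp_cong p 3 S ?R" using zp_cong_iff [OF Sin Rin] by simp
    with q show ?thesis unfolding S_def u_def v_def res nat_int by blast
  qed
  show ?thesis
  proof (cases "int p dvd 2 * x 3 + 1")
    case True
    have "2 * x 3 + 1 = 2 * int a + 1 + int p * (2 * t)" unfolding x3 by simp
    with True have "int p dvd 2 * int a + 1" by (metis dvd_add_left_iff dvd_triv_left)
    then obtain c where c: "2 * int a + 1 = int p * c" by blast
    \<comment> \<open>Since \<open>a < p\<close>, the multiple \<open>2 * a + 1\<close> of
      \<open>p\<close> lies strictly between 0 and \<open>2 * p\<close>, hence equals
      \<open>p\<close>.\<close>
    have "0 < int p * c" "int p * c < int p * 2" using c a by linarith+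
    then have "0 < c" "c < 2" using p_gt_3 by (simp_all add: zero_less_mult_iff)
    then have b: "int p = 2 * int a + 1" using c by simp
    then have b': "p = 2 * a + 1" by linarith
    show ?thesis
    proof (rule conclude)
      \<comment> \<open>With \<open>p = 2 * a + 1\<close> the numerator
        \<open>p + 2 * (x - a)\<close> is exactly \<open>2 * x + 1\<close>, so the quotient is
        1.\<close>
      show "zp_of_int p 1 \<in> zp p" by (rule zp_of_int_in)
      show "zp_mul p u (zp_of_int p 1) = v"
      proof
        fix n
        have "zp_mul p u (zp_of_int p 1) n = (2 * x n + 1) mod int p ^ n"
          by (simp add: u_def zp_mul_def zp_add_def zp_of_int_def mod_simps)
        moreover have "v n = (int p + 2 * (x n - int a)) mod int p ^ n"
          by (simp add: v_def res zp_mul_def zp_add_def zp_diff_def zp_neg_def zp_of_int_def mod_simps)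
        moreover have "int p + 2 * (x n - int a) = 2 * x n + 1" using b by simp
        ultimately show "zp_mul p u (zp_of_int p 1) n = v n" by (simp only:)
      qed
      have "pcong 3 (of_int (S 3)) ((- 1) ^ a)"
        using pcong_trans [OF S3 pcong_sum_s_at_squares_half [OF b' X]] .
      moreover have "zp_of_int p 1 3 = 1"
        using p_gt_3 by (simp add: zp_of_int_def one_less_power)
      ultimately show "pcong 3 (of_int (S 3)) ((- 1) ^ a * of_int (zp_of_int p 1 3))" by simp
    qed
  next
    case False
    have "u 1 = (2 * x 1 + 1) mod int p"
      by (simp add: u_def zp_mul_def zp_add_def zp_of_int_def mod_simps)
    also have "\<dots> = (2 * int a + 1 + int p * (2 * t)) mod int p"
      unfolding x1 ia [symmetric] by (simp only: mod_mult_self2)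
    also have "2 * int a + 1 + int p * (2 * t) = 2 * x 3 + 1" unfolding x3 by simp
    finally have "\<not> int p dvd u 1" using False by (simp add: dvd_mod_iff)
    then obtain q where q: "q \<in> zp p" "zp_mul p u q = v" using zp_divide [OF uin vin] by blast
    have uX: "2 * X + 1 = of_int (2 * x 3 + 1)" by (simp add: X_def)
    have "pcong 3 (of_int (v 3)) ((2 * X + 1) * of_int (q 3))"
      unfolding q(2) [symmetric]
      by (intro pcong_trans [OF pcong_zp_mul] pcong_mult u3 pcong_refl Zp_closed XZ)
    then have "pcong 3 ((2 * X + 1) * of_int (q 3)) (P * (2 * of_int t + 1))"
      using v3 pcong_trans pcong_sym by blast
    then have 1: "pcong 3 ((- 1) ^ a * ((2 * X + 1) * of_int (q 3))) ((- 1) ^ a * (P * (2 * of_int t + 1)))"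
      by (intro pcong_mult_left Zp_closed)
    \<comment> \<open>Both \<open>S\<close> and the signed quotient are compared after
      multiplication by \<open>2 * X + 1\<close>, which is a unit in this case.\<close>
    have "pcong 3 ((2 * X + 1) * of_int (S 3)) ((2 * X + 1) * (\<Sum>n<p. (s_at n X)\<^sup>2))"
      by (intro pcong_mult_left S3 Zp_closed XZ)
    also have "pcong 3 \<dots> ((- 1) ^ a * (P * (2 * of_int t + 1)))"
      using pcong_sum_s_at_squares [OF a X] by (simp only: mult.assoc)
    also have "pcong 3 \<dots> ((- 1) ^ a * ((2 * X + 1) * of_int (q 3)))"
      by (rule pcong_sym [OF 1])
    finally have "pcong 3 ((2 * X + 1) * of_int (S 3)) ((2 * X + 1) * ((- 1) ^ a * of_int (q 3)))"
      by (simp only: mult.left_commute)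
    then have "pcong 3 (of_int (S 3)) ((- 1) ^ a * of_int (q 3))"
    proof (rule pcong_cancel)
      show "inverse (2 * X + 1) \<in> Zp" unfolding uX by (rule Zp_inverse_of_int [OF False])
      show "2 * X + 1 \<noteq> 0" unfolding uX of_int_eq_0_iff using False by auto
    qed
    with q show ?thesis by (rule conclude)
  qed
qed

end
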